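(* Let $\kappa$ be a regular uncountable cardinal, let $U\subseteq{}^{<\kappa}\kappa$ be a slim downward-closed $\kappa$-tree, and suppose $\mathrm{P}_{14}(\kappa,\sqsubseteq,1,\{\kappa\})$ holds. Then there exists a downward-closed $T\subseteq{}^{<\kappa}\kappa$ which is a prolific slim $\kappa$-Souslin tree admitting an injective $(\mathcal F^{\mathrm{fin}}_{\aleph_0},U)$-ascent path.
   Context: Downward-closed subsets of ${}^{<\kappa}\kappa$ are ordered by $\subsetneq$; height is $\mathrm{dom}$; $T_\alpha=T\cap{}^\alpha\kappa$. Prolific: $x^\frown\langle i\rangle\in T$ for all $x\in T_\alpha$, $\alpha<\kappa$, $i<\max\{\omega,\alpha\}$. Slim: $|T_\alpha|\le\max\{|\alpha|,\aleph_0\}$. $\kappa$-tree: height $\kappa$, levels of size $<\kappa$; $\kappa$-Souslin: $\kappa$-tree with no cofinal branch and no antichain of size $\kappa$. $\mathcal F^{\mathrm{fin}}_{\aleph_0}=\{Z\subseteq\omega\mid\omega\setminus Z$ finite$\}$. An $(\mathcal F,U)$-ascent path through $T$ is $\langle f_u\mid u\in U\rangle$ with $f_u:\bigcup\mathcal F\to T_{\mathrm{dom}(u)}$, $\{i\mid f_u(i)\subsetneq f_v(i)\}\in\mathcal F$ for $u\subsetneq v$ in $U$, and $\{i\mid f_u(i)\ne f_v(i)\}\in\mathcal F$ for distinct $u,v\in U$ of the same domain; it is injective if for every $b:\kappa\to\kappa$ with $\{b\restriction\alpha\mid\alpha<\kappa\}\subseteq U$ there are $\alpha<\kappa$ and $I\in\mathcal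 F$ with $f_{b\restriction\alpha}\restriction I$ injective. $\mathrm{P}_{14}(\kappa,\sqsubseteq,1,\{\kappa\})$: $\diamondsuit(\kappa)$ holds and there is $\langle C_\alpha\mid\alpha<\kappa\rangle$ with $C_\alpha$ club in $\alpha$ for limit $\alpha$, $C_{\bar\alpha}=C_\alpha\cap\bar\alpha$ whenever $\bar\alpha\in\mathrm{acc}(C_\alpha)=\{\gamma\in C_\alpha\mid\sup(C_\alpha\cap\gamma)=\gamma>0\}$, and for every cofinal $A\subseteq\kappa$ there are stationarily many $\alpha<\kappa$ with $\sup\{\beta\in C_\alpha\mid\mathrm{succ}_\omega(C_\alpha\setminus\beta)\subseteq A\}=\alpha$, where $\mathrm{succ}_\omega(D)=\{\delta\in D\mid0<\mathrm{otp}(D\cap\delta)<\omega\}$. *)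

theory Defs
  imports Main "HOL-Library.Countable_Set"
begin

text \<open>
Conventions.  The regular uncountable cardinal kappa is represented by a type 'k carrying
a cardinal well-order r with Field r = UNIV; the elements of 'k are exactly the ordinals
below kappa, and "beta < alpha" is "beta \<in> underS r alpha".  An element of
the set of sequences of length less than kappa is a partial map x :: 'k \<rightharpoonup> 'k whose domain is
an initial segment underS r alpha; alpha is then its domain/height.  The tree order
(strict inclusion of sequences) is strict map inclusion.
\<close>

definition ord_lt :: "'k rel \<Rightarrow> 'k \<Rightarrow> 'k \<Rightarrow> bool" where
  "ord_lt r a b \<longleftrightarrow> a \<in> underS r b"

definition ord_le :: "'k rel \<Rightarrow> 'k \<Rightarrow> 'k \<Rightarrow> bool" where
  "ord_le r a b \<longleftrightarrow> (a, b) \<in> r"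

definition is_sup :: "'k rel \<Rightarrow> 'k set \<Rightarrow> 'k \<Rightarrow> bool" where
  "is_sup r X a \<longleftrightarrow> (\<forall>x\<in>X. ord_le r x a) \<and> (\<forall>b. ord_lt r b a \<longrightarrow> (\<exists>x\<in>X. ord_lt r b x))"

definition is_limit :: "'k rel \<Rightarrow> 'k \<Rightarrow> bool" where
  "is_limit r a \<longleftrightarrow> (\<exists>b. ord_lt r b a) \<and> (\<forall>b. ord_lt r b a \<longrightarrow> (\<exists>c. ord_lt r b c \<and> ord_lt r c a))"

definition omega_ord :: "'k rel \<Rightarrow> 'k" where
  "omega_ord r = (THE w. is_limit r w \<and> (\<forall>b. ord_lt r b w \<longrightarrow> \<not> is_limit r b))"

definition acc :: "'k rel \<Rightarrow> 'k set \<Rightarrow> 'k set" where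
  "acc r C = {g\<in>C. is_sup r (C \<inter> underS r g) g \<and> (\<exists>b. ord_lt r b g)}"

definition club_in :: "'k rel \<Rightarrow> 'k set \<Rightarrow> 'k \<Rightarrow> bool" where
  "club_in r C a \<longleftrightarrow> C \<subseteq> underS r a
     \<and> (\<forall>b. ord_lt r b a \<longrightarrow> (\<exists>c\<in>C. ord_lt r b c))
     \<and> (\<forall>g. ord_lt r g a \<and> (\<exists>b. ord_lt r b g) \<and> is_sup r (C \<inter> underS r g) g \<longrightarrow> g \<in> C)"

definition club :: "'k rel \<Rightarrow> 'k set \<Rightarrow> bool" where
  "club r C \<longleftrightarrow> (\<forall>b. \<exists>c\<in>C. ord_lt r b c)
     \<and> (\<forall>g. (\<exists>b. ord_lt r b g) \<and> is_sup r (C \<inter> underS r g) g \<longrightarrow> g \<in> C)"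

definition stationary :: "'k rel \<Rightarrow> 'k set \<Rightarrow> bool" where
  "stationary r S \<longleftrightarrow> (\<forall>C. club r C \<longrightarrow> S \<inter> C \<noteq> {})"

definition diamond :: "'k rel \<Rightarrow> bool" where
  "diamond r \<longleftrightarrow> (\<exists>A :: 'k \<Rightarrow> 'k set. (\<forall>a. A a \<subseteq> underS r a)
      \<and> (\<forall>X :: 'k set. stationary r {a. X \<inter> underS r a = A a}))"

text \<open>succ_omega(D) = {delta in D | 0 < otp(D \<inter> delta) < omega}\<close>
definition succ_omega :: "'k rel \<Rightarrow> 'k set \<Rightarrow> 'k set" where
  "succ_omega r D = {d\<in>D. D \<inter> underS r d \<noteq> {} \<and> finite (D \<inter> underS r d)}"

definition P14 :: "'k rel \<Rightarrow> bool" where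
  "P14 r \<longleftrightarrow> diamond r \<and>
    (\<exists>C :: 'k \<Rightarrow> 'k set.
       (\<forall>a. is_limit r a \<longrightarrow> club_in r (C a) a)
     \<and> (\<forall>a. \<forall>a'\<in>acc r (C a). C a' = C a \<inter> underS r a')
     \<and> (\<forall>A. cofinal A r \<longrightarrow>
          stationary r {a. is_sup r {b\<in>C a. succ_omega r {c\<in>C a. ord_le r b c} \<subseteq> A} a}))"

definition regular_uncountable :: "'k rel \<Rightarrow> bool" where
  "regular_uncountable r \<longleftrightarrow> Card_order r \<and> Field r = UNIV \<and> regularCard r
      \<and> \<not> countable (UNIV :: 'k set)"

definition is_node :: "'k rel \<Rightarrow> ('k \<rightharpoonup> 'k) \<Rightarrow> bool" where
  "is_node r x \<longleftrightarrow> (\<exists>a. dom x = underS r a)"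

definition strict_ext :: "('k \<rightharpoonup> 'k) \<Rightarrow> ('k \<rightharpoonup> 'k) \<Rightarrow> bool" where
  "strict_ext x y \<longleftrightarrow> x \<subseteq>\<^sub>m y \<and> x \<noteq> y"

definition downward_closed :: "'k rel \<Rightarrow> ('k \<rightharpoonup> 'k) set \<Rightarrow> bool" where
  "downward_closed r T \<longleftrightarrow> (\<forall>x\<in>T. is_node r x)
     \<and> (\<forall>x\<in>T. \<forall>y. is_node r y \<and> y \<subseteq>\<^sub>m x \<longrightarrow> y \<in> T)"

definition level :: "'k rel \<Rightarrow> ('k \<rightharpoonup> 'k) set \<Rightarrow> 'k \<Rightarrow> ('k \<rightharpoonup> 'k) set" where
  "level r T a = {x\<in>T. dom x = underS r a}"

definition prolific :: "'k rel \<Rightarrow> ('k \<rightharpoonup> 'k) set \<Rightarrow> bool" where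
  "prolific r T \<longleftrightarrow> (\<forall>a. \<forall>x\<in>level r T a. \<forall>i.
      (ord_lt r i (omega_ord r) \<or> ord_lt r i a) \<longrightarrow> x(a \<mapsto> i) \<in> T)"

definition slim :: "'k rel \<Rightarrow> ('k \<rightharpoonup> 'k) set \<Rightarrow> bool" where
  "slim r T \<longleftrightarrow> (\<forall>a. (card_of (level r T a), card_of (underS r a)) \<in> ordLeq \<or> countable (level r T a))"

definition kappa_tree :: "'k rel \<Rightarrow> ('k \<rightharpoonup> 'k) set \<Rightarrow> bool" where
  "kappa_tree r T \<longleftrightarrow> (\<forall>a. level r T a \<noteq> {}) \<and> (\<forall>a. (card_of (level r T a), r) \<in> ordLess)"

definition tree_chain :: "('k \<rightharpoonup> 'k) set \<Rightarrow> ('k \<rightharpoonup> 'k) set \<Rightarrow> bool" where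
  "tree_chain T B \<longleftrightarrow> B \<subseteq> T \<and> (\<forall>x\<in>B. \<forall>y\<in>B. x \<subseteq>\<^sub>m y \<or> y \<subseteq>\<^sub>m x)"

definition cofinal_branch :: "'k rel \<Rightarrow> ('k \<rightharpoonup> 'k) set \<Rightarrow> ('k \<rightharpoonup> 'k) set \<Rightarrow> bool" where
  "cofinal_branch r T B \<longleftrightarrow> tree_chain T B \<and> (\<forall>B'. tree_chain T B' \<and> B \<subseteq> B' \<longrightarrow> B' = B)
     \<and> (\<forall>a. B \<inter> level r T a \<noteq> {})"

definition antichain :: "('k \<rightharpoonup> 'k) set \<Rightarrow> ('k \<rightharpoonup> 'k) set \<Rightarrow> bool" where
  "antichain T A \<longleftrightarrow> A \<subseteq> T \<and> (\<forall>x\<in>A. \<forall>y\<in>A. x \<noteq> y \<longrightarrow> \<not> strict_ext x y \<and> \<not> strict_ext y x)"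

definition souslin :: "'k rel \<Rightarrow> ('k \<rightharpoonup> 'k) set \<Rightarrow> bool" where
  "souslin r T \<longleftrightarrow> kappa_tree r T \<and> \<not> (\<exists>B. cofinal_branch r T B)
     \<and> \<not> (\<exists>A. antichain T A \<and> (card_of A, r) \<in> ordIso)"

definition Ffin :: "nat set set" where
  "Ffin = {Z. finite (UNIV - Z)}"

definition ascent_path :: "'k rel \<Rightarrow> nat set set \<Rightarrow> ('k \<rightharpoonup> 'k) set \<Rightarrow> ('k \<rightharpoonup> 'k) set
     \<Rightarrow> (('k \<rightharpoonup> 'k) \<Rightarrow> nat \<Rightarrow> ('k \<rightharpoonup> 'k)) \<Rightarrow> bool" where
  "ascent_path r F U T f \<longleftrightarrow>
     (\<forall>u\<in>U. \<forall>i. f u i \<in> T \<and> dom (f u i) = dom u)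
   \<and> (\<forall>u\<in>U. \<forall>v\<in>U. strict_ext u v \<longrightarrow> {i. strict_ext (f u i) (f v i)} \<in> F)
   \<and> (\<forall>u\<in>U. \<forall>v\<in>U. u \<noteq> v \<and> dom u = dom v \<longrightarrow> {i. f u i \<noteq> f v i} \<in> F)"

definition restr_seq :: "'k rel \<Rightarrow> ('k \<Rightarrow> 'k) \<Rightarrow> 'k \<Rightarrow> ('k \<rightharpoonup> 'k)" where
  "restr_seq r b a = (\<lambda>c. if ord_lt r c a then Some (b c) else None)"

definition injective_ascent_path :: "'k rel \<Rightarrow> nat set set \<Rightarrow> ('k \<rightharpoonup> 'k) set \<Rightarrow> ('k \<rightharpoonup> 'k) set
     \<Rightarrow> (('k \<rightharpoonup> 'k) \<Rightarrow> nat \<Rightarrow> ('k \<rightharpoonup> 'k)) \<Rightarrow> bool" where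
  "injective_ascent_path r F U T f \<longleftrightarrow> ascent_path r F U T f \<and>
     (\<forall>b :: 'k \<Rightarrow> 'k. (\<forall>a. restr_seq r b a \<in> U) \<longrightarrow>
        (\<exists>a. \<exists>I\<in>F. inj_on (f (restr_seq r b a)) I))"

end

theory Submission
  imports Defs
begin

text \<open>
The tree is built level by level together with the path.  At a limit level \<open>a\<close> every node below is
extended along the club \<open>C a\<close>: at each successor point of \<open>C a\<close> one moves to a chosen extension
which, whenever possible, passes through an element of the set predicted by diamond at that point.
Coherence makes such a guided walk stay in the tree at accumulation points of \<open>C a\<close>, and a walk is
determined by its starting node, so slimness is preserved.

For a branch \<open>u\<close> of \<open>U\<close> the i-th path node must extend the earlier i-th nodes for almost all \<open>i\<close>.  If
the accumulation points of \<open>C a\<close> are unbounded in \<open>a\<close>, one takes unions along them; for this the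
inclusions between accumulation points are required for all \<open>i\<close>.  Otherwise \<open>C a\<close> has a tail of order type
omega, and the i-th node is a guided walk started at a point of this tail that moves up with \<open>i\<close>.
In the first case the nodes are not guided walks, but they follow one between consecutive accumulation
points; this is why the hitting hypothesis asks for blocks of omega many successive points of \<open>C a\<close>.

Hitting the set of points where diamond guesses a dense set \<open>D\<close> correctly yields a level all of whose
nodes lie above lower elements of \<open>D\<close>.  This excludes large antichains (take \<open>D\<close> to consist of the nodes
that extend an element of the antichain or lie below none) and cofinal branches (take the complement).
\<close>

unbundle cardinal_syntax

section \<open>Regular uncountable cardinals\<close>

type_synonym 'k node = "'k \<rightharpoonup> 'k"

locale reg_card =
  fixes r :: "'k rel"
  assumes reg: "regular_uncountable r"
begin

abbreviation lt (infix "\<prec>" 50) where "a \<prec> b \<equiv> ord_lt r a b"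
abbreviation le (infix "\<preceq>" 50) where "a \<preceq> b \<equiv> ord_le r a b"

lemma Card_order: "Card_order r" and Field: "Field r = UNIV" and regularCard: "regularCard r"
  and uncountable: "\<not> countable (UNIV :: 'k set)"
  using reg by (auto simp: regular_uncountable_def)

lemma Well_order: "Well_order r"
  using Card_order by (simp add: card_order_on_def)

lemma mem_underS [simp]: "a \<in> underS r b \<longleftrightarrow> a \<prec> b"
  by (simp add: ord_lt_def)

sublocale wo: wellorder le lt
proof -
  have L: "refl_on UNIV r" "trans r" "antisym r" "total_on UNIV r" "wf (r - Id)"
    using Well_order Field by (auto simp: well_order_on_def linear_order_on_def
        partial_order_on_def preorder_on_def)
  show "class.wellorder le lt"
  proof
    show "a \<prec> b \<longleftrightarrow> a \<preceq> b \<and> \<not> b \<preceq> a" for a b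
      using L(1,3) by (auto simp: ord_lt_def ord_le_def underS_def antisym_def refl_on_def)
    show "a \<preceq> a" for a using L(1) by (auto simp: ord_le_def refl_on_def)
    show "a \<preceq> b \<Longrightarrow> b \<preceq> c \<Longrightarrow> a \<preceq> c" for a b c using L(2) by (auto simp: ord_le_def dest: transD)
    show "a \<preceq> b \<Longrightarrow> b \<preceq> a \<Longrightarrow> a = b" for a b using L(3) by (auto simp: ord_le_def antisym_def)
    show "a \<preceq> b \<or> b \<preceq> a" for a b
      using L(1,4) unfolding ord_le_def refl_on_def total_on_def by (metis UNIV_I)
    show "P a" if *: "\<And>x. (\<And>y. y \<prec> x \<Longrightarrow> P y) \<Longrightarrow> P x" for P a
      using L(5)
    proof (induction a rule: wf_induct_rule)
      case (less x)
      then show ?case using *[of x] by (simp add: ord_lt_def underS_def)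
    qed
  qed
qed

lemma wf_lt: "wf {(a, b). a \<prec> b}"
  using wo.wf .

lemma card_UNIV: "|UNIV :: 'k set| =o r"
  using card_of_Field_ordIso[OF Card_order] by (simp add: Field)

lemma infinite_UNIV: "infinite (UNIV :: 'k set)"
  using uncountable countable_finite by blast

lemma card_underS: "|underS r a| <o r"
  using card_of_underS[OF Card_order] by (simp add: Field)

lemma ex_pairing: "\<exists>pr :: 'k \<times> 'k \<Rightarrow> 'k. inj pr"
  using card_of_Times_same_infinite[OF infinite_UNIV]
  by (metis UNIV_Times_UNIV card_of_ordLeq ordIso_iff_ordLeq)

lemma countable_card_less: "countable X \<Longrightarrow> |X| <o r"
proof -
  assume "countable X"
  then have *: "|X| \<le>o |UNIV::nat set|"
    by (meson card_of_ordLeq countable_def top_greatest)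
  have "|UNIV::nat set| <o |UNIV :: 'k set|"
    using uncountable card_of_ordLeq[of "UNIV :: 'k set" "UNIV :: nat set"]
    by (metis countableI card_of_Well_order not_ordLeq_iff_ordLess)
  with * card_UNIV show ?thesis
    using ordLeq_ordLess_trans ordLess_ordIso_trans by blast
qed

lemma ex_gt: "\<exists>b. a \<prec> b"
  using infinite_Card_order_limit[OF Card_order, of a] infinite_UNIV
  by (auto simp: Field ord_lt_def underS_def)

text \<open>Regularity of \<kappa>: the image is too small to be cofinal, and since there is no
  largest ordinal below \<kappa> the bound can be made strict.\<close>

lemma bounded_image:
  assumes "|X| <o r" shows "\<exists>b. \<forall>x\<in>X. f x \<prec> b"
proof -
  have "|f ` X| <o r" using assms card_of_image ordLeq_ordLess_trans by blast
  then have "\<not> cofinal (f ` X) r"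
    using regularCard Field unfolding regularCard_def by (metis not_ordLess_ordIso subset_UNIV)
  then obtain a where "\<forall>x\<in>X. \<not> a \<prec> f x"
    by (auto simp: cofinal_def Field ord_lt_def underS_def)
  then have "\<forall>x\<in>X. f x \<preceq> a" by auto
  with ex_gt[of a] show ?thesis by (meson wo.le_less_trans)
qed

definition zero :: 'k where "zero = wo.Least (\<lambda>_. True)"
definition sc :: "'k \<Rightarrow> 'k" where "sc a = wo.Least (\<lambda>b. a \<prec> b)"

lemma zero_le [simp]: "zero \<preceq> a"
  unfolding zero_def by (rule wo.Least_le) simp

lemma not_lt_zero [simp]: "\<not> a \<prec> zero" by (simp add: wo.not_less)

lemma lt_sc [simp]: "a \<prec> sc a"
  unfolding sc_def using ex_gt[of a] wo.LeastI_ex[of "\<lambda>b. a \<prec> b"] by blast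

lemma sc_le_iff [simp]: "sc a \<preceq> b \<longleftrightarrow> a \<prec> b"
  by (metis lt_sc sc_def wo.Least_le wo.less_le_trans)

lemma lt_sc_iff: "a \<prec> sc b \<longleftrightarrow> a \<preceq> b"
  by (metis sc_le_iff wo.leD wo.leI)

lemma sc_inject [simp]: "sc a = sc b \<longleftrightarrow> a = b"
  by (metis lt_sc_iff wo.order_refl wo.order.antisym lt_sc)

lemma underS_sc: "underS r (sc a) = insert a (underS r a)"
  by (auto simp: lt_sc_iff wo.le_less)

lemma underS_zero [simp]: "underS r zero = {}" by auto

lemma ord_cases:
  obtains "a = zero" | b where "a = sc b" | "is_limit r a"
proof (cases "\<exists>b. a = sc b")
  case False
  have "is_limit r a" if "a \<noteq> zero"
  proof -
    have "zero \<prec> a" using that by (metis zero_le wo.le_less)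
    moreover have "sc b \<prec> a" if "b \<prec> a" for b
      using that False by (metis sc_le_iff wo.le_less)
    ultimately show ?thesis unfolding is_limit_def by (meson lt_sc)
  qed
  with that show ?thesis by blast
qed auto

lemma limit_gt_zero: "is_limit r a \<Longrightarrow> zero \<prec> a"
  unfolding is_limit_def by (meson zero_le wo.le_less_trans)

lemma limit_sc: "is_limit r a \<Longrightarrow> b \<prec> a \<Longrightarrow> sc b \<prec> a"
  unfolding is_limit_def by (meson sc_le_iff wo.le_less_trans)

lemma not_limit_zero: "\<not> is_limit r zero"
  by (auto simp: is_limit_def)

lemma not_limit_sc: "\<not> is_limit r (sc b)"
  using limit_sc[of "sc b" b] by auto

lemma underS_inject: "underS r a = underS r b \<Longrightarrow> a = b"
  by (metis mem_underS wo.less_irrefl wo.linorder_cases)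

text \<open>Unboundedness comes from closing off under \<open>g\<close> in \<omega> many rounds: the
  resulting sequence is bounded because \<kappa> is regular and uncountable, and its least strict
  bound is a closure point. Closedness holds since any \<open>a\<close> below a limit of closure
  points lies below one of them.\<close>

lemma club_closure_points: "club r {c. b \<prec> c \<and> (\<forall>a. a \<prec> c \<longrightarrow> g a \<prec> c)}"
  unfolding club_def
proof (intro conjI allI impI)
  fix d
  have "\<exists>s. \<forall>n. (d \<prec> s n \<and> b \<prec> s n) \<and> s n \<prec> s (Suc n) \<and> (\<forall>a. a \<preceq> s n \<longrightarrow> g a \<prec> s (Suc n))"
  proof (rule dependent_nat_choice)
    show "\<exists>x. d \<prec> x \<and> b \<prec> x"
      using wo.linear[of d b] ex_gt by (meson wo.le_less_trans)
  next
    fix x assume "d \<prec> x \<and> b \<prec> x"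
    obtain c where c: "\<forall>a\<in>underS r (sc x). g a \<prec> c"
      using bounded_image[OF card_underS] by blast
    obtain e where "c \<prec> e" "x \<prec> e" by (metis ex_gt wo.less_trans wo.linorder_cases)
    with c \<open>d \<prec> x \<and> b \<prec> x\<close>
    show "\<exists>y. (d \<prec> y \<and> b \<prec> y) \<and> x \<prec> y \<and> (\<forall>a. a \<preceq> x \<longrightarrow> g a \<prec> y)"
      by (intro exI[of _ e]) (auto simp: lt_sc_iff intro: wo.less_trans)
  qed
  then obtain s where s: "\<And>n. d \<prec> s n" "\<And>n. b \<prec> s n" "\<And>n a. a \<preceq> s n \<Longrightarrow> g a \<prec> s (Suc n)" by blast
  have ex: "\<exists>c. \<forall>n. s n \<prec> c" using bounded_image[OF countable_card_less, of "UNIV :: nat set" s] by auto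
  define c where "c = wo.Least (\<lambda>c. \<forall>n. s n \<prec> c)"
  have c: "\<forall>n. s n \<prec> c" unfolding c_def by (rule wo.LeastI_ex) (rule ex)
  have "g a \<prec> c" if "a \<prec> c" for a
  proof -
    have "\<not> (\<forall>n. s n \<prec> a)" using that unfolding c_def by (rule wo.not_less_Least)
    then obtain n where "a \<preceq> s n" by (auto simp: wo.not_less)
    then show ?thesis using s(3) c wo.less_trans by blast
  qed
  with c s show "\<exists>c\<in>{c. b \<prec> c \<and> (\<forall>a. a \<prec> c \<longrightarrow> g a \<prec> c)}. d \<prec> c"
    by (intro bexI[of _ c]) (auto intro: wo.less_trans)
next
  fix x let ?C = "{c. b \<prec> c \<and> (\<forall>a. a \<prec> c \<longrightarrow> g a \<prec> c)}"
  assume x: "(\<exists>b. b \<prec> x) \<and> is_sup r (?C \<inter> underS r x) x"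
  then have *: "\<exists>c\<in>?C \<inter> underS r x. a \<prec> c" if "a \<prec> x" for a
    using that by (simp add: is_sup_def)
  obtain c where "c \<in> ?C \<inter> underS r x" using x * by blast
  then have "b \<prec> x" by (auto intro: wo.less_trans)
  moreover have "g a \<prec> x" if "a \<prec> x" for a using *[OF that] by (auto intro: wo.less_trans)
  ultimately show "x \<in> ?C" by simp
qed

lemma stationary_closure_point:
  assumes "stationary r S"
  obtains c where "c \<in> S" "b \<prec> c" "is_limit r c" "\<And>a. a \<prec> c \<Longrightarrow> g a \<prec> c"
proof -
  \<comment> \<open>\<open>h\<close> dominates both \<open>g\<close> and the successor function;
    closure under the latter makes the point a limit.\<close>
  obtain h where h: "\<And>a. g a \<prec> h a" "\<And>a. sc a \<prec> h a"
  proof -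
    have "\<forall>a. \<exists>x. g a \<prec> x \<and> sc a \<prec> x" by (metis ex_gt wo.less_trans wo.linorder_cases)
    then show ?thesis using that by metis
  qed
  obtain c where c: "c \<in> S" "b \<prec> c" "\<And>a. a \<prec> c \<Longrightarrow> h a \<prec> c"
    using assms club_closure_points[of b h] unfolding stationary_def by blast
  have "is_limit r c" unfolding is_limit_def using c h by (meson lt_sc wo.less_trans)
  then show ?thesis using that c h wo.less_trans by blast
qed

lemma ex_limit: "\<exists>a. is_limit r a"
proof -
  have "stationary r UNIV" using ex_gt unfolding stationary_def club_def by auto
  then show ?thesis using stationary_closure_point by metis
qed

section \<open>The ordinal \<omega> and the bound on the size of levels\<close>

abbreviation om where "om \<equiv> omega_ord r"

lemma om_limit: "is_limit r om" and om_least: "b \<prec> om \<Longrightarrow> \<not> is_limit r b"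
proof -
  have "\<exists>!w. is_limit r w \<and> (\<forall>b. b \<prec> w \<longrightarrow> \<not> is_limit r b)"
  proof (rule ex_ex1I)
    show "\<exists>w. is_limit r w \<and> (\<forall>b. b \<prec> w \<longrightarrow> \<not> is_limit r b)"
      using ex_limit wo.LeastI_ex[of "is_limit r"] wo.not_less_Least by blast
  qed (metis wo.linorder_cases)
  from theI'[OF this] show "is_limit r om" "b \<prec> om \<Longrightarrow> \<not> is_limit r b"
    unfolding omega_ord_def by blast+
qed

lemma limit_infinite:
  assumes "is_limit r a" shows "infinite (underS r a)"
proof
  assume "finite (underS r a)"
  moreover have "underS r a \<noteq> {}" using limit_gt_zero[OF assms] by auto
  ultimately obtain m where m: "m \<prec> a" "\<And>b. b \<prec> a \<Longrightarrow> b \<preceq> m"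
    using wo.finite_has_maximal[of "underS r a"] by (metis mem_underS wo.linear)
  show False using m(2)[OF limit_sc[OF assms m(1)]] by simp
qed

lemma finite_below_om: "b \<prec> om \<Longrightarrow> finite (underS r b)"
proof (induction b rule: wo.less_induct)
  case (less b)
  show ?case
  proof (cases b rule: ord_cases)
    case (2 c)
    then show ?thesis using less lt_sc wo.less_trans by (simp add: underS_sc)
  qed (use less om_least in auto)
qed

lemma countable_om: "countable (underS r om)"
proof -
  have "inj_on (\<lambda>b. card (underS r b)) (underS r om)"
  proof (rule inj_onI)
    have *: "card (underS r x) < card (underS r y)" if "x \<prec> y" "y \<prec> om" for x y
      by (rule psubset_card_mono[OF finite_below_om[OF that(2)]])
        (use that(1) in \<open>auto intro: wo.less_trans\<close>)
    fix x y assume "x \<in> underS r om" "y \<in> underS r om" "card (underS r x) = card (underS r y)"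
    then show "x = y" using *[of x y] *[of y x] by (cases x y rule: wo.linorder_cases) auto
  qed
  then show ?thesis by (rule countableI)
qed

text \<open>An infinite set of size \<open>max |a| aleph_0\<close>, so that slimness becomes a single inequality.\<close>
definition M :: "'k \<Rightarrow> 'k set" where "M a = underS r a \<union> underS r om"

lemma M_infinite: "infinite (M a)"
  using limit_infinite[OF om_limit] by (simp add: M_def)

lemma M_mono: "a \<preceq> b \<Longrightarrow> |M a| \<le>o |M b|"
  by (rule card_of_mono1) (auto simp: M_def intro: wo.less_le_trans)

lemma nat_le_M: "|UNIV::nat set| \<le>o |M a|"
  using M_infinite infinite_iff_card_of_nat by blast

lemma countable_le_M: "countable X \<Longrightarrow> |X| \<le>o |M a|"
  by (meson card_of_ordLeq countable_def nat_le_M ordLeq_transitive top_greatest)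

lemma underS_le_M: "|underS r a| \<le>o |M a|"
  by (rule card_of_mono1) (auto simp: M_def)

text \<open>\<open>M a\<close> equals \<open>underS r a\<close> if \<open>om \<preceq> a\<close> and
  equals the countable set \<open>underS r om\<close> otherwise; these two cases match the two
  disjuncts of \<open>slim\<close>.\<close>

lemma slim_iff: "slim r T \<longleftrightarrow> (\<forall>a. |level r T a| \<le>o |M a| )"
proof -
  have "( |X| \<le>o |underS r a| \<or> countable X) \<longleftrightarrow> |X| \<le>o |M a|" for X :: "('k \<rightharpoonup> 'k) set" and a
  proof
    assume "|X| \<le>o |M a|"
    show "|X| \<le>o |underS r a| \<or> countable X"
    proof (cases "om \<preceq> a")
      case True
      then have "M a = underS r a" by (auto simp: M_def intro: wo.less_le_trans)
      with \<open>|X| \<le>o |M a|\<close> show ?thesis by simp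
    next
      case False
      then have "M a = underS r om" by (auto simp: M_def intro: wo.less_trans)
      with \<open>|X| \<le>o |M a|\<close> obtain f where "inj_on f X" "f ` X \<subseteq> underS r om"
        by (metis card_of_ordLeq)
      then show ?thesis by (meson countable_om countable_image_inj_on countable_subset)
    qed
  qed (use countable_le_M underS_le_M ordLeq_transitive in blast)
  then show ?thesis unfolding slim_def by blast
qed

lemma M_less: "|M a| <o r"
proof -
  have "M a \<subseteq> underS r (sc (if a \<prec> om then om else a))"
    by (auto simp: M_def lt_sc_iff intro: wo.less_imp_le wo.less_le_trans)
  then show ?thesis using card_underS card_of_mono1 ordLeq_ordLess_trans by blast
qed

lemma M_sc_le: "|M (sc a)| \<le>o |M a|"
proof -
  have "M (sc a) = insert a (M a)" by (auto simp: M_def underS_sc)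
  then show ?thesis using M_infinite infinite_imp_bij_betw2
    by (metis card_of_ordIso ordIso_iff_ordLeq bij_betw_inv Un_insert_right sup_bot_right)
qed

lemma Times_le_M: "|X| \<le>o |M a| \<Longrightarrow> |Y| \<le>o |M a| \<Longrightarrow> |X \<times> Y| \<le>o |M a|"
  by (rule card_of_Sigma_ordLeq_infinite[OF M_infinite]) auto

lemma Un_le_M: "|X| \<le>o |M a| \<Longrightarrow> |Y| \<le>o |M a| \<Longrightarrow> |X \<union> Y| \<le>o |M a|"
  using card_of_Un_ordLeq_infinite_Field[of "|M a|" X Y] M_infinite
  by (simp add: card_of_card_order_on Field_card_of)


section \<open>Nodes and clubs\<close>

abbreviation res :: "'k node \<Rightarrow> 'k \<Rightarrow> 'k node" where "res y a \<equiv> y |` underS r a"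

lemma res_res [simp]: "b \<preceq> a \<Longrightarrow> res (res y a) b = res y b"
  by (rule ext) (auto simp: restrict_map_def intro: wo.less_le_trans)

lemma underS_Int [simp]: "b \<preceq> a \<Longrightarrow> underS r a \<inter> underS r b = underS r b"
  by (auto intro: wo.less_le_trans)

lemma res_self [simp]: "dom y = underS r a \<Longrightarrow> res y a = y"
  by (auto simp: restrict_map_def fun_eq_iff) (metis domIff mem_underS)

lemma dom_res [simp]: "dom y = underS r a \<Longrightarrow> b \<preceq> a \<Longrightarrow> dom (res y b) = underS r b"
  by (auto intro: wo.less_le_trans)

lemma map_le_iff_res: "dom x = underS r a \<Longrightarrow> x \<subseteq>\<^sub>m y \<longleftrightarrow> res y a = x"
  by (auto simp: map_le_def restrict_map_def fun_eq_iff) (metis domIff mem_underS)+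

lemma level_res:
  assumes "downward_closed r U" "u \<in> level r U a" "b \<preceq> a" shows "res u b \<in> level r U b"
proof -
  have "dom (res u b) = underS r b" using assms(2,3) by (intro dom_res) (auto simp: level_def)
  moreover have "res u b \<subseteq>\<^sub>m u" by (simp add: map_le_def)
  ultimately show ?thesis using assms(1,2) unfolding downward_closed_def level_def is_node_def by blast
qed

lemma node_eqI:
  assumes "dom y = underS r a" "dom z = underS r a"
    and "\<And>b. b \<prec> a \<Longrightarrow> \<exists>d\<in>D. b \<prec> d" "\<And>d. d \<in> D \<Longrightarrow> res y d = res z d"
  shows "y = z"
proof
  fix c show "y c = z c"
  proof (cases "c \<prec> a")
    case True
    then obtain d where "d \<in> D" "c \<prec> d" using assms(3) by blast
    then show ?thesis using assms(4)[of d] by (metis mem_underS restrict_in)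
  next
    case False
    then show ?thesis using assms(1,2) by (metis domIff mem_underS)
  qed
qed

text \<open>The union of a coherent system of nodes; its value at \<open>c\<close> is read off from
  an arbitrarily chosen \<open>d\<close> in \<open>D\<close> above \<open>c\<close>, and coherence
  makes the choice irrelevant.\<close>

lemma glue:
  assumes D: "\<And>b. b \<prec> a \<Longrightarrow> \<exists>d\<in>D. b \<prec> d" "\<And>d. d \<in> D \<Longrightarrow> d \<prec> a"
    and Y: "\<And>d. d \<in> D \<Longrightarrow> dom (Y d) = underS r d"
      "\<And>d d'. d \<in> D \<Longrightarrow> d' \<in> D \<Longrightarrow> d \<prec> d' \<Longrightarrow> res (Y d') d = Y d"
  obtains y where "dom y = underS r a" "\<And>d. d \<in> D \<Longrightarrow> res y d = Y d"
proof -
  define s where "s c = (SOME d. d \<in> D \<and> c \<prec> d)" for c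
  have s: "s c \<in> D" "c \<prec> s c" if "c \<prec> a" for c
    using D(1)[OF that] unfolding s_def by (metis (mono_tags, lifting) someI_ex)+
  define y where "y c = (if c \<prec> a then Y (s c) c else None)" for c
  have *: "Y d' c = Y d c" if "d \<in> D" "d' \<in> D" "d \<prec> d'" "c \<prec> d" for c d d'
    using Y(2)[OF that(1-3)] that(4) by (metis mem_underS restrict_in)
  have y: "y c = Y d c" if "d \<in> D" "c \<prec> d" for c d
  proof -
    have "c \<prec> a" using that D(2) wo.less_trans by blast
    then show ?thesis using s[of c] that *[of d "s c" c] *[of "s c" d c]
      by (cases d "s c" rule: wo.linorder_cases) (auto simp: y_def)
  qed
  show ?thesis
  proof
    show "dom y = underS r a"
    proof (intro set_eqI iffI)
      fix c assume c: "c \<in> underS r a"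
      then have "c \<in> dom (Y (s c))" using Y(1) s by simp
      with c show "c \<in> dom y" by (simp add: y_def dom_def)
    qed (auto simp: y_def split: if_splits)
    show "res y d = Y d" if "d \<in> D" for d
    proof
      fix c show "res y d c = Y d c"
        using y[OF that, of c] domIff[of c "Y d"] Y(1)[OF that] by (cases "c \<prec> d") auto
    qed
  qed
qed

section \<open>Consecutive points and accumulation points of a club\<close>

definition consec :: "'k set \<Rightarrow> 'k \<Rightarrow> 'k \<Rightarrow> bool" where
  "consec D b c \<longleftrightarrow> b \<in> D \<and> c \<in> D \<and> b \<prec> c \<and> (\<forall>d\<in>D. \<not> (b \<prec> d \<and> d \<prec> c))"

lemma club_in_lt: "club_in r D a \<Longrightarrow> d \<in> D \<Longrightarrow> d \<prec> a"
  by (auto simp: club_in_def)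

lemma club_in_unbounded: "club_in r D a \<Longrightarrow> b \<prec> a \<Longrightarrow> \<exists>d\<in>D. b \<prec> d"
  by (auto simp: club_in_def)

lemma ex_consec:
  assumes "club_in r D a" "b \<in> D" obtains c where "consec D b c"
proof
  let ?P = "\<lambda>c. c \<in> D \<and> b \<prec> c"
  have "Ex ?P" using assms by (meson club_in_lt club_in_unbounded)
  from wo.LeastI_ex[OF this] wo.not_less_Least[of _ ?P] show "consec D b (wo.Least ?P)"
    using assms(2) unfolding consec_def by blast
qed

lemma acc_limit: "c \<in> acc r D \<Longrightarrow> is_limit r c"
  by (auto simp: acc_def is_sup_def is_limit_def) (metis Int_iff mem_underS)

lemma not_consec_acc: "c \<in> acc r D \<Longrightarrow> \<not> consec D b c"
  by (auto simp: acc_def is_sup_def consec_def) (metis Int_iff mem_underS)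

lemma club_in_closed:
  assumes "club_in r D a" "s \<prec> a" "b \<prec> s" "\<And>d. d \<prec> s \<Longrightarrow> \<exists>x\<in>D. d \<prec> x \<and> x \<prec> s"
  shows "s \<in> acc r D"
proof -
  have "is_sup r (D \<inter> underS r s) s"
    using assms(4) unfolding is_sup_def by (metis Int_iff mem_underS wo.less_imp_le)
  with assms show ?thesis unfolding club_in_def acc_def by blast
qed

text \<open>Take the least \<open>d\<close> below \<open>c\<close> with no point of \<open>D\<close>
  strictly between \<open>d\<close> and \<open>c\<close>. If it exists, it belongs to
  \<open>D\<close>, being otherwise an accumulation point of \<open>D\<close>, and so it precedes
  \<open>c\<close> immediately. If there is none, points of \<open>D\<close> accumulate at
  \<open>c\<close>.\<close>

lemma pred_or_acc:
  assumes D: "club_in r D a" and "b \<in> D" "c \<in> D" "b \<prec> c"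
  obtains p where "consec D p c" "b \<preceq> p" | "c \<in> acc r D"
proof (cases "\<forall>d. d \<prec> c \<longrightarrow> (\<exists>x\<in>D. d \<prec> x \<and> x \<prec> c)")
  case True
  with that(2) club_in_closed[OF D club_in_lt[OF D \<open>c \<in> D\<close>] \<open>b \<prec> c\<close>] show ?thesis by blast
next
  case False
  let ?P = "\<lambda>d. d \<prec> c \<and> \<not> (\<exists>x\<in>D. d \<prec> x \<and> x \<prec> c)"
  define d where "d = wo.Least ?P"
  have "Ex ?P" using False by blast
  from wo.LeastI_ex[OF this] have d: "d \<prec> c" "\<And>x. x \<in> D \<Longrightarrow> d \<prec> x \<Longrightarrow> \<not> x \<prec> c"
    unfolding d_def by blast+
  have bd: "b \<preceq> d" using d assms by (metis wo.leI)
  have "d \<in> D"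
  proof (rule ccontr)
    assume "d \<notin> D"
    then have "b \<prec> d" using bd \<open>b \<in> D\<close> by (metis wo.le_less)
    have "d \<in> acc r D"
    proof (rule club_in_closed[OF D _ \<open>b \<prec> d\<close>])
      show "d \<prec> a" using d(1) club_in_lt[OF D \<open>c \<in> D\<close>] wo.less_trans by blast
      fix e assume "e \<prec> d"
      then obtain x where "x \<in> D" "e \<prec> x" "x \<prec> c"
        using wo.not_less_Least[of e ?P] d(1) wo.less_trans unfolding d_def[symmetric] by blast
      then show "\<exists>x\<in>D. e \<prec> x \<and> x \<prec> d"
        using d(2)[of x] \<open>d \<notin> D\<close> by (metis wo.linorder_cases)
    qed
    with \<open>d \<notin> D\<close> show False by (simp add: acc_def)
  qed
  with d assms have "consec D d c" unfolding consec_def by blast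
  with that(1) bd show ?thesis by blast
qed

text \<open>Without accumulation points in (b, c] one can descend from \<open>c\<close> to its
  predecessor in \<open>D\<close> again and again; well-foundedness ends the descent at
  \<open>b\<close> after finitely many moves.\<close>

lemma finite_between:
  assumes D: "club_in r D a" and b: "b \<in> D"
    and "c \<in> D" "b \<preceq> c" "\<And>d. d \<in> acc r D \<Longrightarrow> b \<prec> d \<Longrightarrow> \<not> d \<preceq> c"
  shows "finite {d\<in>D. b \<preceq> d \<and> d \<prec> c}"
  using assms(3-5)
proof (induction c rule: wo.less_induct)
  case (less c)
  show ?case
  proof (cases "b = c")
    case True
    then have "{d\<in>D. b \<preceq> d \<and> d \<prec> c} = {}" by (auto simp: wo.not_less)
    show ?thesis unfolding \<open>_ = {}\<close> by simp
  next
    case False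
    then have "b \<prec> c" using less.prems by (simp add: wo.le_less)
    with less.prems obtain p where p: "consec D p c" "b \<preceq> p"
      using pred_or_acc[OF D b] by (metis wo.order_refl)
    have "finite {d\<in>D. b \<preceq> d \<and> d \<prec> p}"
    proof (rule less.IH)
      fix d assume "d \<in> acc r D" "b \<prec> d"
      then show "\<not> d \<preceq> p"
        using less.prems(3) p by (metis consec_def wo.le_less_trans wo.less_imp_le)
    qed (use p in \<open>auto simp: consec_def\<close>)
    moreover have "{d\<in>D. b \<preceq> d \<and> d \<prec> c} \<subseteq> insert p {d\<in>D. b \<preceq> d \<and> d \<prec> p}"
      using p(1) by (auto simp: consec_def)
    ultimately show ?thesis using finite_subset by blast
  qed
qed

text \<open>Any strictly increasing sequence of points of \<open>D\<close> starting at
  \<open>b\<close> is cofinal: if it stayed below some point of \<open>D\<close>, it would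
  contradict \<open>finite_between\<close>.\<close>

lemma cofinal_sequence:
  assumes D: "club_in r D a" and b: "b \<in> D"
    and noacc: "\<And>d. d \<in> acc r D \<Longrightarrow> \<not> b \<prec> d"
  obtains e :: "nat \<Rightarrow> 'k" where "e 0 = b" "\<And>n. e n \<in> D" "\<And>m n. m < n \<Longrightarrow> e m \<prec> e n"
    "\<And>d. d \<prec> a \<Longrightarrow> \<exists>n. d \<prec> e n"
proof -
  have "\<exists>e. \<forall>n. (e n \<in> D \<and> b \<preceq> e n \<and> (n = 0 \<longrightarrow> e n = b)) \<and> e n \<prec> e (Suc n)"
  proof (rule dependent_nat_choice)
    show "\<exists>x. x \<in> D \<and> b \<preceq> x \<and> (0 = (0::nat) \<longrightarrow> x = b)" using b by auto
    fix x n assume "x \<in> D \<and> b \<preceq> x \<and> (n = (0::nat) \<longrightarrow> x = b)"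
    then obtain y where "y \<in> D" "x \<prec> y" using club_in_unbounded[OF D club_in_lt[OF D]] by blast
    with \<open>x \<in> D \<and> _\<close> show "\<exists>y. (y \<in> D \<and> b \<preceq> y \<and> (Suc n = 0 \<longrightarrow> y = b)) \<and> x \<prec> y"
      by (auto dest: wo.le_less_trans wo.less_imp_le)
  qed
  then obtain e where e: "\<And>n. e n \<in> D" "\<And>n. b \<preceq> e n" "e 0 = b" "\<And>n. e n \<prec> e (Suc n)" by blast
  have mono: "e m \<prec> e n" if "m < n" for m n using wo.lift_Suc_mono_less[of e m n] e(4) that by blast
  show ?thesis
  proof (rule that[of e])
    fix d assume "d \<prec> a"
    show "\<exists>n. d \<prec> e n"
    proof (rule ccontr)
      assume *: "\<nexists>n. d \<prec> e n"
      obtain c where c: "c \<in> D" "d \<prec> c" using club_in_unbounded[OF D \<open>d \<prec> a\<close>] by blast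
      have lt: "e n \<prec> c" for n using * c(2) by (metis wo.leI wo.le_less_trans)
      have "finite {d\<in>D. b \<preceq> d \<and> d \<prec> c}"
      proof (rule finite_between[OF D b c(1)])
        show "b \<preceq> c" using lt[of 0] e(3) wo.less_imp_le by simp
      qed (use noacc in blast)
      moreover have "range e \<subseteq> {d\<in>D. b \<preceq> d \<and> d \<prec> c}" using e lt by auto
      moreover have "inj e" using mono by (metis injI wo.less_irrefl linorder_neqE_nat)
      ultimately show False using finite_subset range_inj_infinite by blast
    qed
  qed (use e mono in auto)
qed

lemma acc_coherent:
  assumes "c \<in> acc r D" "c' \<in> acc r D" "c \<prec> c'" shows "c \<in> acc r (D \<inter> underS r c')"
proof -
  have "D \<inter> underS r c' \<inter> underS r c = D \<inter> underS r c" using assms(3) by (auto intro: wo.less_trans)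
  then show ?thesis using assms by (auto simp: acc_def)
qed

text \<open>The bound \<open>b\<close> keeps the supremum of the accumulation points below
  \<open>a\<close>, and there a limit of points of \<open>D\<close> is itself an accumulation point
  of \<open>D\<close>.\<close>

lemma acc_bound:
  assumes D: "club_in r D a" and b: "b \<prec> a" "\<And>d. d \<in> acc r D \<Longrightarrow> \<not> b \<prec> d" and ne: "acc r D \<noteq> {}"
  obtains s where "s \<in> acc r D" "\<And>d. d \<in> acc r D \<Longrightarrow> d \<preceq> s"
proof -
  let ?P = "\<lambda>s. \<forall>d\<in>acc r D. d \<preceq> s"
  define s where "s = wo.Least ?P"
  have "?P b" using b(2) by (meson wo.leI)
  then have s: "?P s" and sb: "s \<preceq> b" unfolding s_def by (rule wo.LeastI, rule wo.Least_le)
  have "s \<in> acc r D"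
  proof (rule ccontr)
    assume *: "s \<notin> acc r D"
    obtain d where d: "d \<in> acc r D" using ne by blast
    have lt: "d \<prec> s" if "d \<in> acc r D" for d using s * that by (metis wo.le_less)
    have "s \<in> acc r D"
    proof (rule club_in_closed[OF D])
      show "s \<prec> a" using sb b(1) wo.le_less_trans by blast
      show "d \<prec> s" using d lt by blast
      fix e assume "e \<prec> s"
      then have "\<not> ?P e" unfolding s_def by (rule wo.not_less_Least)
      then obtain x where "x \<in> acc r D" "e \<prec> x" by (auto simp: wo.not_le)
      with lt show "\<exists>x\<in>D. e \<prec> x \<and> x \<prec> s" by (auto simp: acc_def)
    qed
    with * show False by blast
  qed
  with s that show ?thesis by blast
qed

end

section \<open>Levels of the tree\<close>

text \<open>A level of the tree together with the path nodes on that level.\<close>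
type_synonym 'k stage = "'k node set \<times> ('k node \<Rightarrow> nat \<Rightarrow> 'k node)"

locale slim_construction = reg_card r for r :: "'k rel" +
  fixes U :: "'k node set" and C A :: "'k \<Rightarrow> 'k set" and pr :: "'k \<times> 'k \<Rightarrow> 'k"
  assumes U_closed: "downward_closed r U" and U_slim: "slim r U"
    and C_club: "is_limit r a \<Longrightarrow> club_in r (C a) a"
    and C_coherent: "c \<in> acc r (C a) \<Longrightarrow> C c = C a \<inter> underS r c"
    and C_hits: "cofinal B r \<Longrightarrow>
      stationary r {a. is_sup r {b\<in>C a. succ_omega r {c\<in>C a. b \<preceq> c} \<subseteq> B} a}"
    and A_guess: "stationary r {a. X \<inter> underS r a = A a}"
    and inj_pr: "inj pr"
begin

section \<open>Guided walks and the requirements on a level\<close>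

abbreviation Ul where "Ul \<equiv> level r U"

definition enc :: "'k node set \<Rightarrow> 'k node \<Rightarrow> 'k" where
  "enc t = (SOME e. inj_on e t)"

text \<open>Diamond guesses sets of ordinals; a node \<open>x\<close> on level \<open>g\<close> is coded by pairing \<open>g\<close> with an
  ordinal chosen injectively on that level.\<close>
definition guess :: "('k \<Rightarrow> 'k stage) \<Rightarrow> 'k \<Rightarrow> 'k \<Rightarrow> 'k node set" where
  "guess G b g = {x\<in>fst (G g). pr (g, enc (fst (G g)) x) \<in> A b}"

definition hits :: "('k \<Rightarrow> 'k stage) \<Rightarrow> 'k \<Rightarrow> 'k node \<Rightarrow> bool" where
  "hits G b y \<longleftrightarrow> (\<exists>g. g \<prec> b \<and> res y g \<in> guess G b g)"

text \<open>For given levels the choice depends only on \<open>c\<close>, \<open>b\<close> and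
  \<open>x\<close>, so a walk has no freedom after its start. Hitting is demanded only if some
  extension achieves it, so a suitable \<open>y\<close> exists as soon as \<open>x\<close> has an
  extension on level \<open>c\<close>.\<close>

definition step :: "('k \<Rightarrow> 'k stage) \<Rightarrow> 'k \<Rightarrow> 'k \<Rightarrow> 'k node \<Rightarrow> 'k node" where
  "step G c b x = (SOME y. y \<in> fst (G c) \<and> res y b = x \<and>
     ((\<exists>z\<in>fst (G c). res z b = x \<and> hits G c z) \<longrightarrow> hits G c y))"

text \<open>At accumulation points of \<open>D\<close> no step is prescribed, since there the node
  is the union of its earlier restrictions. The end \<open>a\<close> may be a point of
  \<open>D\<close> or its supremum; both cases occur while a walk is being built.\<close>

definition guided :: "('k \<Rightarrow> 'k stage) \<Rightarrow> 'k set \<Rightarrow> 'k \<Rightarrow> 'k node \<Rightarrow> 'k \<Rightarrow> bool" where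
  "guided G D b0 y a \<longleftrightarrow> dom y = underS r a \<and> (\<forall>b. b \<prec> a \<longrightarrow> res y b \<in> fst (G b)) \<and>
     (\<forall>b c. consec D b c \<and> b0 \<preceq> b \<and> c \<preceq> a \<longrightarrow> res y c = step G c b (res y b))"

text \<open>The property of guided walks, weakened so that it also holds for the path nodes, which suffices
  for passing through the guessed sets.\<close>
definition sealed :: "('k \<Rightarrow> 'k stage) \<Rightarrow> 'k \<Rightarrow> 'k node \<Rightarrow> bool" where
  "sealed G a y \<longleftrightarrow> (\<exists>b1\<in>C a. \<forall>b\<in>C a. b1 \<preceq> b \<longrightarrow>
     (\<exists>p c. consec (C a) p c \<and> b \<preceq> p \<and> c \<in> succ_omega r {d\<in>C a. b \<preceq> d} \<and>
       res y c = step G c p (res y p)))"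

text \<open>The recursion hypothesis: \<open>t\<close> is the new level, \<open>\<phi>\<close> the
  path on it, and \<open>G\<close> matters only below \<open>a\<close>. At successors the path nodes
  for all pairs \<open>(u, i)\<close> are distinct, the source of both inequality requirements on
  the path. At limits, admitting every guided walk lets later walks survive at accumulation points,
  and agreement on \<open>acc r (C a)\<close> for every \<open>i\<close>, not just for almost every
  \<open>i\<close>, lets unions be taken along accumulation points.\<close>

definition spec :: "('k \<Rightarrow> 'k stage) \<Rightarrow> 'k \<Rightarrow> 'k stage \<Rightarrow> bool" where
  "spec G a = (\<lambda>(t, \<phi>).
     (\<forall>y\<in>t. dom y = underS r a \<and> (\<forall>b. b \<prec> a \<longrightarrow> res y b \<in> fst (G b))) \<and>
     t \<noteq> {} \<and>
     (\<forall>b. b \<prec> a \<longrightarrow> (\<forall>x\<in>fst (G b). \<exists>y\<in>t. res y b = x)) \<and>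
     |t| \<le>o |M a| \<and>
     (\<forall>b. a = sc b \<longrightarrow> t = (\<lambda>(x, i). x(b \<mapsto> i)) ` (fst (G b) \<times> M b) \<and>
       inj_on (\<lambda>(u, i). \<phi> u i) (Ul a \<times> UNIV)) \<and>
     (is_limit r a \<longrightarrow> (\<forall>b0\<in>C a. \<forall>y. guided G (C a) b0 y a \<longrightarrow> y \<in> t) \<and>
       (\<forall>y\<in>t. sealed G a y) \<and>
       (\<forall>c\<in>acc r (C a). \<forall>u\<in>Ul a. \<forall>i. res (\<phi> u i) c = snd (G c) (res u c) i)) \<and>
     (\<forall>u\<in>Ul a. \<forall>i. \<phi> u i \<in> t) \<and>
     (\<forall>u\<in>Ul a. \<forall>b. b \<prec> a \<longrightarrow> finite {i. res (\<phi> u i) b \<noteq> snd (G b) (res u b) i}))"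

lemma Ul_le_M: "|Ul a| \<le>o |M a|"
  using U_slim by (simp add: slim_iff)

lemma Ul_res: "u \<in> Ul a \<Longrightarrow> b \<preceq> a \<Longrightarrow> res u b \<in> Ul b"
  using level_res[OF U_closed] .

lemma dom_Ul: "u \<in> Ul a \<Longrightarrow> dom u = underS r a"
  by (simp add: level_def)

lemma C_lt: "is_limit r a \<Longrightarrow> c \<in> C a \<Longrightarrow> c \<prec> a"
  using C_club club_in_lt by blast

lemma C_nonempty: "is_limit r a \<Longrightarrow> C a \<noteq> {}"
  using club_in_unbounded[OF C_club] limit_gt_zero by blast

section \<open>Dependence of a level on earlier levels only\<close>

lemma guess_cong: "(\<And>z. z \<prec> a \<Longrightarrow> G z = G' z) \<Longrightarrow> g \<prec> a \<Longrightarrow> guess G b g = guess G' b g"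
  by (simp add: guess_def)

lemma hits_cong: "(\<And>z. z \<prec> a \<Longrightarrow> G z = G' z) \<Longrightarrow> b \<preceq> a \<Longrightarrow> hits G b y = hits G' b y"
  unfolding hits_def using guess_cong[of a G G'] wo.less_le_trans by metis

text \<open>The strict bound \<open>c \<prec> a\<close> matters: a step chooses its value from level
  \<open>c\<close> itself.\<close>

lemma step_cong: "(\<And>z. z \<prec> a \<Longrightarrow> G z = G' z) \<Longrightarrow> c \<prec> a \<Longrightarrow> step G c b x = step G' c b x"
  unfolding step_def using hits_cong[of a G G' c] by (simp add: wo.less_imp_le)

lemma guided_cong:
  assumes "is_limit r a" "\<And>z. z \<prec> a \<Longrightarrow> G z = G' z"
  shows "guided G (C a) b0 y a = guided G' (C a) b0 y a"
proof -
  have "step G c b x = step G' c b x" if "consec (C a) b c" for b c x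
    using step_cong[of a G G'] assms(2) that C_lt[OF assms(1)] by (simp add: consec_def)
  with assms(2) show ?thesis unfolding guided_def by (simp cong: conj_cong imp_cong)
qed

lemma sealed_cong:
  assumes "is_limit r a" "\<And>z. z \<prec> a \<Longrightarrow> G z = G' z"
  shows "sealed G a y = sealed G' a y"
proof -
  have "step G c b x = step G' c b x" if "consec (C a) b c" for b c x
    using step_cong[of a G G'] assms(2) that C_lt[OF assms(1)] by (simp add: consec_def)
  then show ?thesis unfolding sealed_def by (simp cong: conj_cong imp_cong)
qed

lemma spec_cong_imp:
  assumes G: "\<And>z. z \<prec> a \<Longrightarrow> G z = G' z" and s: "spec G a p"
  shows "spec G' a p"
proof -
  obtain t \<phi> where p: "p = (t, \<phi>)" by fastforce
  have *: "G c = G' c" if "is_limit r a" "c \<in> acc r (C a)" for c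
    using that C_lt G by (auto simp: acc_def)
  have sc: "G b = G' b" if "a = sc b" for b using that G by simp
  show ?thesis
    using s unfolding p spec_def prod.case
    apply (elim conjE)
    apply (intro conjI)
    subgoal using G by simp
    subgoal by simp
    subgoal using G by simp
    subgoal by simp
    subgoal using sc by simp
    subgoal using guided_cong[of a G G'] sealed_cong[of a G G'] * G by (simp)
    subgoal by simp
    subgoal using G by simp
    done
qed

text \<open>This locality is the condition under which the levels can be chosen by well-founded
  recursion in \<open>stages_exist\<close>.\<close>

lemma spec_cong: "(\<And>z. z \<prec> a \<Longrightarrow> G z = G' z) \<Longrightarrow> spec G a p = spec G' a p"
  using spec_cong_imp[of a G G' p] spec_cong_imp[of a G' G p] by auto

lemma specD:
  assumes "spec G a (G a)"
  shows spec_dom: "y \<in> fst (G a) \<Longrightarrow> dom y = underS r a"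
    and spec_res: "y \<in> fst (G a) \<Longrightarrow> b \<preceq> a \<Longrightarrow> res y b \<in> fst (G b)"
    and spec_nonempty: "fst (G a) \<noteq> {}"
    and spec_normal: "b \<preceq> a \<Longrightarrow> x \<in> fst (G b) \<Longrightarrow> \<exists>y\<in>fst (G a). res y b = x"
    and spec_card: "|fst (G a)| \<le>o |M a|"
    and spec_sc: "a = sc b \<Longrightarrow> fst (G a) = (\<lambda>(x, i). x(b \<mapsto> i)) ` (fst (G b) \<times> M b)"
    and spec_inj: "a = sc b \<Longrightarrow> inj_on (\<lambda>(u, i). snd (G a) u i) (Ul a \<times> UNIV)"
    and spec_guided: "is_limit r a \<Longrightarrow> b0 \<in> C a \<Longrightarrow> guided G (C a) b0 y a \<Longrightarrow> y \<in> fst (G a)"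
    and spec_sealed: "is_limit r a \<Longrightarrow> y \<in> fst (G a) \<Longrightarrow> sealed G a y"
    and spec_acc: "is_limit r a \<Longrightarrow> c \<in> acc r (C a) \<Longrightarrow> u \<in> Ul a \<Longrightarrow>
      res (snd (G a) u i) c = snd (G c) (res u c) i"
    and spec_path: "u \<in> Ul a \<Longrightarrow> snd (G a) u i \<in> fst (G a)"
    and spec_finite: "u \<in> Ul a \<Longrightarrow> b \<prec> a \<Longrightarrow> finite {i. res (snd (G a) u i) b \<noteq> snd (G b) (res u b) i}"
proof -
  obtain t \<phi> where p: "G a = (t, \<phi>)" by fastforce
  note s = assms[unfolded p spec_def prod.case]
  show dom: "y \<in> fst (G a) \<Longrightarrow> dom y = underS r a" for y using s p by simp
  show "y \<in> fst (G a) \<Longrightarrow> b \<preceq> a \<Longrightarrow> res y b \<in> fst (G b)" for y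
    using s p dom[of y] by (cases "a = b") (simp_all add: wo.le_less)
  show "b \<preceq> a \<Longrightarrow> x \<in> fst (G b) \<Longrightarrow> \<exists>y\<in>fst (G a). res y b = x"
    using s p dom[of x] by (cases "a = b") (auto simp: wo.le_less)
qed (use assms in \<open>auto simp: spec_def split: prod.splits\<close>)


section \<open>Coherence, uniqueness, existence and number of guided walks\<close>

lemma step_props:
  assumes "spec G c (G c)" "b \<preceq> c" "x \<in> fst (G b)"
  shows step_in: "step G c b x \<in> fst (G c)" and step_res: "res (step G c b x) b = x"
    and step_hits: "\<exists>z\<in>fst (G c). res z b = x \<and> hits G c z \<Longrightarrow> hits G c (step G c b x)"
proof -
  have "\<exists>y. y \<in> fst (G c) \<and> res y b = x \<and>
     ((\<exists>z\<in>fst (G c). res z b = x \<and> hits G c z) \<longrightarrow> hits G c y)"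
    using spec_normal[OF assms] by blast
  from someI_ex[OF this] show "step G c b x \<in> fst (G c)" "res (step G c b x) b = x"
    "\<exists>z\<in>fst (G c). res z b = x \<and> hits G c z \<Longrightarrow> hits G c (step G c b x)"
    unfolding step_def by blast+
qed

text \<open>\<open>C c\<close> is the part of \<open>C a\<close> below \<open>c\<close>, and
  \<open>c\<close> itself ends no consecutive pair, being an accumulation point. Hence both clubs
  prescribe the same steps up to \<open>c\<close>.\<close>

lemma guided_coherent:
  assumes c: "c \<in> acc r (C a)"
  shows "guided G (C c) b0 y c \<longleftrightarrow> guided G (C a) b0 y c"
proof -
  have "consec (C c) p d \<and> b0 \<preceq> p \<and> d \<preceq> c \<longleftrightarrow> consec (C a) p d \<and> b0 \<preceq> p \<and> d \<preceq> c" for p d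
  proof (cases "d = c")
    case True
    then show ?thesis using not_consec_acc[OF c] by (auto simp: consec_def C_coherent[OF c])
  next
    case False
    then show ?thesis
      by (auto simp: consec_def C_coherent[OF c] wo.le_less dest: wo.less_trans)
  qed
  then show ?thesis by (simp add: guided_def)
qed

text \<open>Induction along \<open>D\<close>: at a point with a predecessor both nodes take the
  value of the same step, and at an accumulation point they agree because they agree on cofinally
  many earlier points.\<close>

lemma guided_unique:
  assumes D: "club_in r D a" and y: "guided G D b0 y d" and z: "guided G D b0 z e"
    and eq: "res y b0 = res z b0" and b0: "b0 \<in> D"
    and c: "c \<in> D" "b0 \<preceq> c" "c \<preceq> d" "c \<preceq> e"
  shows "res y c = res z c"
  using c
proof (induction c rule: wo.less_induct)
  case (less c)
  show ?case
  proof (cases "c = b0")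
    case False
    then have "b0 \<prec> c" using less.prems by (simp add: wo.le_less)
    from pred_or_acc[OF D b0 \<open>c \<in> D\<close> this] show ?thesis
    proof cases
      case (1 p)
      then have "p \<prec> c" "p \<in> D" by (auto simp: consec_def)
      then have "res y p = res z p"
        using less.IH[of p] less.prems 1 by (metis wo.less_imp_le wo.order_trans)
      then show ?thesis using y z 1 less.prems unfolding guided_def by metis
    next
      case 2
      show ?thesis
      proof (rule node_eqI[where a = c and D = "{x\<in>D. b0 \<prec> x \<and> x \<prec> c}"])
        show "dom (res y c) = underS r c" "dom (res z c) = underS r c"
          using y z less.prems by (auto simp: guided_def simp del: dom_restrict intro!: dom_res)
        fix b assume "b \<prec> c"
        then obtain b' where b': "b \<preceq> b'" "b0 \<preceq> b'" "b' \<prec> c"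
          using \<open>b0 \<prec> c\<close> by (metis wo.linear wo.order_refl)
        then obtain x where "x \<in> D" "b' \<prec> x" "x \<prec> c"
          using 2 by (auto simp: acc_def is_sup_def)
        with b' show "\<exists>d\<in>{x \<in> D. b0 \<prec> x \<and> x \<prec> c}. b \<prec> d"
          by (auto intro: wo.le_less_trans)
      next
        fix x assume "x \<in> {x \<in> D. b0 \<prec> x \<and> x \<prec> c}"
        then show "res (res y c) x = res (res z c) x"
          using less.IH[of x] less.prems by (auto intro: wo.less_imp_le wo.order_trans)
      qed
    qed
  qed (use eq in simp)
qed

lemma guided_exists:
  assumes a: "is_limit r a" and S: "\<And>b. b \<prec> a \<Longrightarrow> spec G b (G b)"
    and b0: "b0 \<in> C a" and x: "x \<in> fst (G b0)"
  obtains y where "guided G (C a) b0 y a" "res y b0 = x"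
proof -
  let ?D = "C a"
  note D = C_club[OF a]
  \<comment> \<open>Level \<open>a\<close> is not constructed yet, so membership is claimed only for
    \<open>d \<prec> a\<close>.\<close>
  have "\<exists>y. guided G ?D b0 y d \<and> res y b0 = x \<and> (d \<prec> a \<longrightarrow> y \<in> fst (G d))"
    if "d \<in> insert a ?D" "b0 \<preceq> d" for d
    using that
  proof (induction d rule: wo.less_induct)
    case (less d)
    have da: "d \<preceq> a" using less.prems(1) C_lt[OF a] wo.less_imp_le by auto
    have accI: "d \<in> acc r ?D" if "\<And>b. b \<prec> d \<Longrightarrow> \<exists>e\<in>?D. b \<prec> e \<and> e \<prec> d" "d \<prec> a" "b0 \<prec> d"
      by (rule club_in_closed[OF D that(2,3,1)])
    consider "d = b0" | p where "consec ?D p d" "b0 \<preceq> p"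
      | "b0 \<prec> d" "\<And>b. b \<prec> d \<Longrightarrow> \<exists>e\<in>?D. b \<prec> e \<and> e \<prec> d"
    proof (cases "d = a")
      case True
      have "b0 \<prec> a" using C_lt[OF a b0] .
      moreover have "\<exists>e\<in>?D. b \<prec> e \<and> e \<prec> a" if "b \<prec> a" for b
        using club_in_unbounded[OF D that] C_lt[OF a] by blast
      ultimately show thesis using that(3) True by simp
    next
      case False
      then have "d \<in> ?D" using less.prems by simp
      show thesis
      proof (cases "d = b0")
        case False
        then have "b0 \<prec> d" using less.prems by (simp add: wo.le_less)
        from pred_or_acc[OF D b0 \<open>d \<in> ?D\<close> this] show thesis
        proof cases
          case 2
          have "\<exists>e\<in>?D. b \<prec> e \<and> e \<prec> d" if "b \<prec> d" for b
            using 2 that by (auto simp: acc_def is_sup_def) (metis Int_iff mem_underS)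
          then show thesis using that(3) \<open>b0 \<prec> d\<close> by blast
        qed (rule that(2))
      qed (rule that(1))
    qed
    then show ?case
    proof cases
      case 1
      have s: "spec G b0 (G b0)" using S C_lt[OF a b0] by blast
      have "guided G ?D b0 x b0" unfolding guided_def
        using spec_dom[OF s x] spec_res[OF s x]
        by (auto simp: consec_def wo.less_imp_le dest: wo.leD wo.le_less_trans)
      then show ?thesis using 1 x spec_dom[OF s x] by auto
    next
      case (2 p)
      then have pd: "p \<prec> d" "p \<in> ?D" "d \<in> ?D" by (auto simp: consec_def)
      then have pa: "p \<prec> a" and dA: "d \<prec> a" using C_lt[OF a] by auto
      obtain z where z: "guided G ?D b0 z p" "res z b0 = x" "z \<in> fst (G p)"
        using less.IH[OF pd(1)] pd 2 pa by auto
      let ?y = "step G d p z"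
      note sd = S[OF dA]
      have y: "?y \<in> fst (G d)" "res ?y p = z"
        using step_props(1,2)[OF sd wo.less_imp_le[OF pd(1)] z(3)] by auto
      have le: "c \<preceq> p" if "consec ?D b c" "c \<preceq> d" "c \<noteq> d" for b c
        using that 2(1) by (metis consec_def wo.le_less wo.not_less)
      have yc: "res ?y c = res z c" if "c \<preceq> p" for c
        using that by (metis y(2) res_res)
      have "guided G ?D b0 ?y d"
        unfolding guided_def
      proof (intro conjI allI impI)
        show dy: "dom ?y = underS r d" using spec_dom[OF sd y(1)] .
        show "res ?y b \<in> fst (G b)" if "b \<prec> d" for b
          using spec_res[OF sd y(1)] that wo.less_imp_le by blast
        fix b c assume bc: "consec ?D b c \<and> b0 \<preceq> b \<and> c \<preceq> d"
        show "res ?y c = step G c b (res ?y b)"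
        proof (cases "c = d")
          case True
          then have "b = p" using bc 2(1) unfolding consec_def by (metis wo.linorder_cases)
          then show ?thesis using True y dy by simp
        next
          case False
          then have "c \<preceq> p" using le bc by blast
          moreover have "b \<preceq> p" using calculation bc by (auto simp: consec_def dest: wo.less_le_trans wo.less_imp_le)
          ultimately show ?thesis using z(1) bc yc unfolding guided_def by metis
        qed
      qed
      then show ?thesis using y z(2) yc[OF 2(2)] by auto
    next
      case 3
      let ?E = "{e\<in>?D. b0 \<prec> e \<and> e \<prec> d}"
      have E: "\<exists>e\<in>?E. b \<prec> e" if b: "b \<prec> d" for b
      proof -
        obtain b' where b': "b \<preceq> b'" "b0 \<preceq> b'" "b' \<prec> d"
          using b \<open>b0 \<prec> d\<close> by (metis wo.linear wo.order_refl)
        then obtain e where "e \<in> ?D" "b' \<prec> e" "e \<prec> d" using 3(2) by blast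
        with b' wo.le_less_trans[of _ b' e] show ?thesis by blast
      qed
      have "\<forall>e\<in>?E. \<exists>y. guided G ?D b0 y e \<and> res y b0 = x \<and> y \<in> fst (G e)"
      proof
        fix e assume "e \<in> ?E"
        then show "\<exists>y. guided G ?D b0 y e \<and> res y b0 = x \<and> y \<in> fst (G e)"
          using less.IH[of e] C_lt[OF a, of e] by (auto simp: wo.less_imp_le)
      qed
      from bchoice[OF this] obtain Y where Y: "\<And>e. e \<in> ?E \<Longrightarrow> guided G ?D b0 (Y e) e"
        "\<And>e. e \<in> ?E \<Longrightarrow> res (Y e) b0 = x" by blast
      have dY: "dom (Y e) = underS r e" if "e \<in> ?E" for e using Y(1)[OF that] by (simp add: guided_def)
      \<comment> \<open>The walks \<open>Y e\<close> were chosen separately for each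
        \<open>e\<close>; uniqueness of guided walks makes them coherent.\<close>
      obtain y where y: "dom y = underS r d" "\<And>e. e \<in> ?E \<Longrightarrow> res y e = Y e"
      proof (rule glue[of d ?E Y])
        fix e e' assume e: "e \<in> ?E" "e' \<in> ?E" "e \<prec> e'"
        then have "res (Y e') e = res (Y e) e"
          using guided_unique[OF D Y(1)[OF e(2)] Y(1)[OF e(1)] _ b0, of e] Y(2)[OF e(1)] Y(2)[OF e(2)]
          by (auto simp: wo.less_imp_le)
        then show "res (Y e') e = Y e" using dY[OF e(1)] by simp
      qed (use E dY in auto)
      have yr: "res y c = res (Y e) c" if "e \<in> ?E" "c \<preceq> e" for c e
        using y(2)[OF that(1)] that(2) by (metis res_res)
      have g: "guided G ?D b0 y d"
        unfolding guided_def
      proof (intro conjI allI impI y)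
        show "res y b \<in> fst (G b)" if b: "b \<prec> d" for b
        proof -
          obtain e where e: "e \<in> ?E" "b \<prec> e" using E[OF b] by blast
          then show ?thesis using yr[of e b] Y(1)[of e] by (simp add: guided_def wo.less_imp_le)
        qed
        fix b c assume bc: "consec ?D b c \<and> b0 \<preceq> b \<and> c \<preceq> d"
        then have "c \<prec> d" using 3(2)[of b] unfolding consec_def by (metis wo.le_less)
        then obtain e where e: "e \<in> ?E" "c \<prec> e" using E by blast
        then have "res (Y e) c = step G c b (res (Y e) b)"
          using Y(1)[OF e(1)] bc unfolding guided_def by (metis wo.less_imp_le)
        moreover have "b \<prec> c" using bc by (simp add: consec_def)
        ultimately show "res y c = step G c b (res y b)"
          using yr[OF e(1)] e(2) wo.less_imp_le wo.less_trans by metis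
      qed
      moreover obtain e where e: "e \<in> ?E" "b0 \<prec> e" using E \<open>b0 \<prec> d\<close> by blast
      then have "res y b0 = x" using yr[of e b0] Y(2) by (simp add: wo.less_imp_le)
      moreover have "y \<in> fst (G d)" if "d \<prec> a"
      proof -
        have d: "d \<in> acc r ?D" using accI 3 that by blast
        have "b0 \<in> C d" using b0 3(1) C_coherent[OF d] by simp
        then show ?thesis
          using spec_guided[OF S[OF that] acc_limit[OF d]] g guided_coherent[OF d] by blast
      qed
      ultimately show ?thesis by blast
    qed
  qed
  from this[of a] C_lt[OF a b0] obtain y where "guided G ?D b0 y a \<and> res y b0 = x"
    by (auto simp: wo.less_imp_le)
  with that show thesis by blast
qed

text \<open>From the start on, every consecutive pair is a prescribed step, and the successor of
  \<open>b\<close> in \<open>C a\<close> is already the first point counted by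
  \<open>succ_omega\<close>.\<close>

lemma guided_sealed:
  assumes a: "is_limit r a" and b0: "b0 \<in> C a" and y: "guided G (C a) b0 y a"
  shows "sealed G a y"
  unfolding sealed_def
proof (intro bexI[OF _ b0] ballI impI)
  fix b assume b: "b \<in> C a" "b0 \<preceq> b"
  obtain c where c: "consec (C a) b c" using ex_consec[OF C_club[OF a] b(1)] .
  then have "c \<in> C a" "b \<prec> c" by (auto simp: consec_def)
  have "{d\<in>C a. b \<preceq> d} \<inter> underS r c = {b}"
    using c by (auto simp: consec_def wo.le_less)
  with \<open>c \<in> C a\<close> \<open>b \<prec> c\<close> have "c \<in> succ_omega r {d\<in>C a. b \<preceq> d}"
    by (simp add: succ_omega_def wo.less_imp_le)
  moreover have "res y c = step G c b (res y b)"
    using y c b C_lt[OF a \<open>c \<in> C a\<close>] unfolding guided_def by (simp add: wo.less_imp_le)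
  ultimately show "\<exists>p c. consec (C a) p c \<and> b \<preceq> p \<and> c \<in> succ_omega r {d \<in> C a. b \<preceq> d} \<and>
      res y c = step G c p (res y p)" using c by blast
qed

text \<open>A walk is determined by its restriction to its starting point, a node of an earlier
  level; there are at most \<open>|M a|\<close> starting points and at most \<open>|M a|\<close>
  nodes over each.\<close>

lemma card_guided:
  assumes a: "is_limit r a" and S: "\<And>b. b \<prec> a \<Longrightarrow> spec G b (G b)"
  shows "|{y. \<exists>b0\<in>C a. guided G (C a) b0 y a}| \<le>o |M a|"
proof -
  let ?Y = "\<lambda>b0. {y. guided G (C a) b0 y a}"
  have "|?Y b0| \<le>o |M a|" if b0: "b0 \<in> C a" for b0
  proof -
    have ba: "b0 \<prec> a" using C_lt[OF a b0] .
    have "inj_on (\<lambda>y. res y b0) (?Y b0)"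
    proof (rule inj_onI)
      fix y z assume yz: "y \<in> ?Y b0" "z \<in> ?Y b0" "res y b0 = res z b0"
      show "y = z"
      proof (rule node_eqI[where a = a and D = "{c\<in>C a. b0 \<preceq> c}"])
        fix b assume "b \<prec> a"
        then obtain b' where "b \<preceq> b'" "b0 \<preceq> b'" "b' \<prec> a"
          using ba by (metis wo.linear wo.order_refl)
        with club_in_unbounded[OF C_club[OF a], of b'] show "\<exists>d\<in>{c \<in> C a. b0 \<preceq> c}. b \<prec> d"
          by (auto dest: wo.le_less_trans wo.less_imp_le)
      next
        fix d assume "d \<in> {c \<in> C a. b0 \<preceq> c}"
        then show "res y d = res z d"
          using guided_unique[OF C_club[OF a] _ _ yz(3) b0, of G a a d] yz(1,2) C_lt[OF a]
          by (auto simp: wo.less_imp_le)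
      qed (use yz in \<open>auto simp: guided_def\<close>)
    qed
    moreover have "(\<lambda>y. res y b0) ` ?Y b0 \<subseteq> fst (G b0)" using ba by (auto simp: guided_def)
    ultimately have "|?Y b0| \<le>o |fst (G b0)|" by (meson card_of_ordLeq)
    moreover have "|fst (G b0)| \<le>o |M b0|" using spec_card[OF S[OF ba]] .
    moreover have "|M b0| \<le>o |M a|" using M_mono[OF wo.less_imp_le[OF ba]] .
    ultimately show ?thesis by (rule ordLeq_transitive[OF _ ordLeq_transitive])
  qed
  moreover have "|C a| \<le>o |M a|"
    by (rule card_of_mono1) (use C_lt[OF a] in \<open>auto simp: M_def\<close>)
  ultimately have "|\<Union>b0\<in>C a. ?Y b0| \<le>o |M a|"
    by (intro card_of_UNION_ordLeq_infinite M_infinite) auto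
  moreover have "{y. \<exists>b0\<in>C a. guided G (C a) b0 y a} = (\<Union>b0\<in>C a. ?Y b0)" by auto
  ultimately show ?thesis by simp
qed


text \<open>\<open>C c\<close> is the part of \<open>C a\<close> below \<open>c\<close>, so sealing
  at \<open>c\<close> supplies a step \<open>p\<close>, \<open>d\<close> with
  \<open>b \<preceq> p\<close> and \<open>d \<prec> c\<close>. No accumulation point of
  \<open>C a\<close> lies strictly between \<open>b\<close> and \<open>c\<close>, so only finitely
  many points of \<open>C a\<close> lie between \<open>b\<close> and \<open>d\<close>, as
  \<open>succ_omega\<close> demands.\<close>

lemma sealed_restrict:
  assumes a: "is_limit r a" and b: "b \<in> C a"
    and c: "c \<in> acc r (C a)" "b \<prec> c" and least: "\<And>d. d \<in> acc r (C a) \<Longrightarrow> b \<prec> d \<Longrightarrow> c \<preceq> d"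
    and s: "sealed G c (res y c)"
  shows "\<exists>p d. consec (C a) p d \<and> b \<preceq> p \<and> d \<in> succ_omega r {x\<in>C a. b \<preceq> x} \<and>
      res y d = step G d p (res y p)"
proof -
  note Cc = C_coherent[OF c(1)]
  obtain b1 where b1: "b1 \<in> C c" and *: "\<And>b. b \<in> C c \<Longrightarrow> b1 \<preceq> b \<Longrightarrow> \<exists>p d. consec (C c) p d \<and> b \<preceq> p \<and>
      res (res y c) d = step G d p (res (res y c) p)"
    using s unfolding sealed_def by blast
  have "b \<in> C c" using b c(2) Cc by simp
  with b1 obtain b' where "b' \<in> C c" "b1 \<preceq> b'" "b \<preceq> b'" by (metis wo.linear wo.order_refl)
  with * obtain p d where pd: "consec (C c) p d" "b' \<preceq> p"
      "res (res y c) d = step G d p (res (res y c) p)" by blast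
  have lt: "p \<prec> d" "d \<prec> c" "p \<prec> c" "p \<in> C a" "d \<in> C a"
    using pd(1) Cc by (auto simp: consec_def)
  have "b \<preceq> p" using \<open>b \<preceq> b'\<close> pd(2) wo.order_trans by blast
  have "b \<prec> d" using \<open>b \<preceq> p\<close> lt(1) wo.le_less_trans by blast
  have "consec (C a) p d" using pd(1) Cc lt unfolding consec_def
    by (metis Int_iff mem_underS wo.less_trans)
  have eq: "res y d = step G d p (res y p)"
    using pd(3) lt by (simp add: wo.less_imp_le)
  have "finite {x\<in>C a. b \<preceq> x \<and> x \<prec> d}"
  proof (rule finite_between[OF C_club[OF a] b lt(5)])
    show "b \<preceq> d" using \<open>b \<prec> d\<close> by (rule wo.less_imp_le)
    fix x assume "x \<in> acc r (C a)" "b \<prec> x"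
    then show "\<not> x \<preceq> d" using least lt(2) by (metis wo.le_less_trans wo.not_le)
  qed
  moreover have "{x\<in>C a. b \<preceq> x} \<inter> underS r d = {x\<in>C a. b \<preceq> x \<and> x \<prec> d}" by auto
  moreover have "p \<in> {x\<in>C a. b \<preceq> x} \<inter> underS r d" using lt \<open>b \<preceq> p\<close> by simp
  ultimately have "d \<in> succ_omega r {x\<in>C a. b \<preceq> x}"
    using lt \<open>b \<prec> d\<close> by (auto simp: succ_omega_def wo.less_imp_le)
  with \<open>consec (C a) p d\<close> \<open>b \<preceq> p\<close> eq show ?thesis by blast
qed

section \<open>Path nodes on limit levels\<close>

definition limit_path :: "('k \<Rightarrow> 'k stage) \<Rightarrow> 'k \<Rightarrow> 'k node \<Rightarrow> (nat \<Rightarrow> 'k node) \<Rightarrow> bool" where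
  "limit_path G a u \<psi> \<longleftrightarrow>
     (\<forall>i. dom (\<psi> i) = underS r a \<and> (\<forall>b. b \<prec> a \<longrightarrow> res (\<psi> i) b \<in> fst (G b)) \<and> sealed G a (\<psi> i)) \<and>
     (\<forall>b. b \<prec> a \<longrightarrow> finite {i. res (\<psi> i) b \<noteq> snd (G b) (res u b) i}) \<and>
     (\<forall>c\<in>acc r (C a). \<forall>i. res (\<psi> i) c = snd (G c) (res u c) i)"

text \<open>By coherence and \<open>spec_acc\<close> the i-th nodes at accumulation points extend
  each other for every \<open>i\<close>, so their union exists. Its sealing at \<open>b\<close> is
  inherited from the least accumulation point above \<open>b\<close>, and the finiteness condition
  from any accumulation point above the given level.\<close>

lemma limit_path_acc:
  assumes a: "is_limit r a" and S: "\<And>b. b \<prec> a \<Longrightarrow> spec G b (G b)" and u: "u \<in> Ul a"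
    and cof: "\<And>b. b \<prec> a \<Longrightarrow> \<exists>c\<in>acc r (C a). b \<prec> c"
  shows "\<exists>\<psi>. limit_path G a u \<psi>"
proof -
  let ?f = "\<lambda>c. snd (G c) (res u c)"
  let ?D = "acc r (C a)"
  have lt: "c \<prec> a" if "c \<in> ?D" for c using that C_lt[OF a] by (simp add: acc_def)
  have uc: "res u c \<in> Ul c" if "c \<prec> a" for c by (rule Ul_res[OF u]) (simp add: that wo.less_imp_le)
  have T: "?f c i \<in> fst (G c)" if "c \<in> ?D" for c i
    using spec_path[OF S[OF lt[OF that]] uc[OF lt[OF that]]] .
  have "\<exists>y. dom y = underS r a \<and> (\<forall>c\<in>?D. res y c = ?f c i)" for i
  proof -
    obtain y where "dom y = underS r a" "\<And>c. c \<in> ?D \<Longrightarrow> res y c = ?f c i"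
    proof (rule glue[of a ?D "\<lambda>c. ?f c i"])
      show "dom (?f c i) = underS r c" if "c \<in> ?D" for c
        using spec_dom[OF S[OF lt[OF that]] T[OF that]] .
      fix c d assume cd: "c \<in> ?D" "d \<in> ?D" "c \<prec> d"
      then have "c \<in> acc r (C d)" using acc_coherent[OF cd] C_coherent[OF cd(2)] by simp
      then have "res (?f d i) c = snd (G c) (res (res u d) c) i"
        using spec_acc[OF S acc_limit[OF cd(2)]] lt[OF cd(2)] uc by blast
      then show "res (?f d i) c = ?f c i" using cd(3) by (simp add: wo.less_imp_le)
    qed (use cof lt in auto)
    then show ?thesis by blast
  qed
  then obtain \<psi> where \<psi>: "\<And>i. dom (\<psi> i) = underS r a" "\<And>i c. c \<in> ?D \<Longrightarrow> res (\<psi> i) c = ?f c i"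
    by metis
  have "res (\<psi> i) b \<in> fst (G b)" if b: "b \<prec> a" for i b
  proof -
    obtain c where c: "c \<in> ?D" "b \<prec> c" using cof[OF b] by blast
    then have "res (?f c i) b \<in> fst (G b)"
      using spec_res[OF S[OF lt[OF c(1)]] T[OF c(1)]] by (simp add: wo.less_imp_le)
    then show ?thesis using \<psi>(2)[OF c(1), of i, symmetric] c(2) by (simp add: wo.less_imp_le)
  qed
  moreover have "sealed G a (\<psi> i)" for i
  proof -
    obtain b1 where b1: "b1 \<in> C a" using C_nonempty[OF a] by blast
    show ?thesis unfolding sealed_def
    proof (intro bexI[OF _ b1] ballI impI)
      fix b assume b: "b \<in> C a"
      let ?P = "\<lambda>c. c \<in> ?D \<and> b \<prec> c"
      have ex: "Ex ?P" using cof[OF C_lt[OF a b]] by blast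
      define c where "c = wo.Least ?P"
      have c: "c \<in> ?D" "b \<prec> c" using wo.LeastI_ex[OF ex] unfolding c_def by blast+
      show "\<exists>p d. consec (C a) p d \<and> b \<preceq> p \<and> d \<in> succ_omega r {x\<in>C a. b \<preceq> x} \<and>
         res (\<psi> i) d = step G d p (res (\<psi> i) p)"
      proof (rule sealed_restrict[OF a b c])
        show "c \<preceq> d" if "d \<in> ?D" "b \<prec> d" for d unfolding c_def by (rule wo.Least_le) (simp add: that)
        show "sealed G c (res (\<psi> i) c)"
          using spec_sealed[OF S[OF lt[OF c(1)]] acc_limit[OF c(1)] T[OF c(1)]] \<psi>(2)[OF c(1)] by simp
      qed
    qed
  qed
  moreover have "finite {i. res (\<psi> i) b \<noteq> ?f b i}" if b: "b \<prec> a" for b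
  proof -
    obtain c where c: "c \<in> ?D" "b \<prec> c" using cof[OF b] by blast
    have "finite {i. res (?f c i) b \<noteq> snd (G b) (res (res u c) b) i}"
      using spec_finite[OF S[OF lt[OF c(1)]] uc[OF lt[OF c(1)]] c(2)] .
    moreover have "res (?f c i) b = res (\<psi> i) b" for i
      using \<psi>(2)[OF c(1), of i, symmetric] c(2) by (simp add: wo.less_imp_le)
    ultimately show ?thesis using c(2) by (simp add: wo.less_imp_le)
  qed
  ultimately show ?thesis using \<psi> unfolding limit_path_def by (intro exI[of _ \<psi>]) blast
qed

text \<open>Below, \<open>K i\<close> collects the initial segments of \<open>e\<close> along which the i-th nodes form a chain; the
  bound \<open>n \<le> i\<close> only serves to make it finite.\<close>
lemma limit_path_sequence:
  fixes e :: "nat \<Rightarrow> 'k"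
  assumes a: "is_limit r a" and S: "\<And>b. b \<prec> a \<Longrightarrow> spec G b (G b)" and u: "u \<in> Ul a"
    and e: "\<And>n. e n \<in> C a" "\<And>m n. m < n \<Longrightarrow> e m \<prec> e n" "\<And>b. b \<prec> a \<Longrightarrow> \<exists>n. b \<prec> e n"
    and acc: "\<And>c. c \<in> acc r (C a) \<Longrightarrow> c = e 0 \<or> c \<in> acc r (C (e 0)) \<and> is_limit r (e 0)"
  shows "\<exists>\<psi>. limit_path G a u \<psi>"
proof -
  define f where "f c = snd (G c) (res u c)" for c
  have ea: "e n \<prec> a" for n using e(1) C_lt[OF a] by blast
  have Se: "spec G (e n) (G (e n))" for n using S ea by blast
  have ue: "res u (e n) \<in> Ul (e n)" for n by (rule Ul_res[OF u]) (simp add: ea wo.less_imp_le)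
  have T: "f (e n) i \<in> fst (G (e n))" for n i
    unfolding f_def using spec_path[OF Se ue] .
  define K where "K i = {n. n \<le> i \<and> (\<forall>m\<le>n. \<forall>m'\<le>n. m < m' \<longrightarrow> res (f (e m') i) (e m) = f (e m) i)}" for i
  define N where "N i = Max (K i)" for i
  have finK: "finite (K i)" for i by (rule finite_subset[of _ "{..i}"]) (auto simp: K_def)
  have K0: "0 \<in> K i" for i by (simp add: K_def)
  have NK: "N i \<in> K i" for i unfolding N_def using Max_in[OF finK] K0 by blast
  have NK_ge: "n \<le> N i" if "n \<in> K i" for n i unfolding N_def using Max_ge[OF finK that] .
  \<comment> \<open>\<open>e (N i)\<close> is the last point up to which \<open>K i\<close>
    certifies a chain, so a walk started there extends the i-th node at \<open>e n\<close> for every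
    \<open>n\<close> in \<open>K i\<close>.\<close>
  have "\<exists>y. guided G (C a) (e (N i)) y a \<and> res y (e (N i)) = f (e (N i)) i" for i
    using guided_exists[OF a S e(1) T] by metis
  then obtain \<psi> where \<psi>: "\<And>i. guided G (C a) (e (N i)) (\<psi> i) a"
      "\<And>i. res (\<psi> i) (e (N i)) = f (e (N i)) i" by metis
  have \<psi>K: "res (\<psi> i) (e n) = f (e n) i" if n: "n \<in> K i" for n i
  proof (cases "n = N i")
    case False
    then have "n < N i" using NK_ge[OF n] by simp
    then have "res (f (e (N i)) i) (e n) = f (e n) i" using NK[of i] unfolding K_def by auto
    then show ?thesis using \<psi>(2)[of i, symmetric] e(2)[OF \<open>n < N i\<close>] by (simp add: wo.less_imp_le)
  qed (use \<psi> in simp)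
  have fin: "finite {i. res (f (e n) i) b \<noteq> f b i}" if "b \<prec> e n" for n b
    using spec_finite[OF Se ue that] that by (simp add: f_def wo.less_imp_le)
  \<comment> \<open>For fixed \<open>n\<close>, finitely many pairs \<open>m < m'\<close> are
    compared, each failing for finitely many \<open>i\<close> only, and the condition
    \<open>n \<le> i\<close> excludes finitely many more. Thus \<open>N i\<close> tends to infinity
    with \<open>i\<close>.\<close>
  have notK: "finite {i. n \<notin> K i}" for n
  proof -
    have "{i. n \<notin> K i} \<subseteq> {..<n} \<union> (\<Union>m'\<in>{..n}. \<Union>m\<in>{..<m'}. {i. res (f (e m') i) (e m) \<noteq> f (e m) i})"
      by (auto simp: K_def)
    moreover have "finite \<dots>" using fin e(2) by auto
    ultimately show ?thesis by (rule finite_subset)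
  qed
  have "finite {i. res (\<psi> i) b \<noteq> f b i}" if b: "b \<prec> a" for b
  proof -
    obtain n where n: "b \<prec> e n" using e(3)[OF b] by blast
    have "res (\<psi> i) b = f b i" if "n \<in> K i" "res (f (e n) i) b = f b i" for i
      using \<psi>K[OF that(1), symmetric] that(2) n by (simp add: wo.less_imp_le)
    then have "{i. res (\<psi> i) b \<noteq> f b i} \<subseteq> {i. n \<notin> K i} \<union> {i. res (f (e n) i) b \<noteq> f b i}" by blast
    then show ?thesis using notK fin[OF n] by (meson finite_Un finite_subset)
  qed
  \<comment> \<open>Agreement for every \<open>i\<close> is possible here because all accumulation
    points lie at or below \<open>e 0\<close>, and \<open>0\<close> belongs to every
    \<open>K i\<close>.\<close>
  moreover have "res (\<psi> i) c = f c i" if c: "c \<in> acc r (C a)" for c i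
    using acc[OF c]
  proof
    assume "c = e 0" then show ?thesis using \<psi>K[OF K0] by simp
  next
    assume *: "c \<in> acc r (C (e 0)) \<and> is_limit r (e 0)"
    then have "c \<prec> e 0" using C_lt by (simp add: acc_def)
    moreover have "res (f (e 0) i) c = snd (G c) (res (res u (e 0)) c) i"
      unfolding f_def using spec_acc[OF Se] * ue by blast
    ultimately show ?thesis using \<psi>K[OF K0[of i], symmetric] by (simp add: f_def wo.less_imp_le)
  qed
  moreover have "dom (\<psi> i) = underS r a \<and> (\<forall>b. b \<prec> a \<longrightarrow> res (\<psi> i) b \<in> fst (G b)) \<and> sealed G a (\<psi> i)" for i
    using \<psi>(1)[of i] guided_sealed[OF a e(1) \<psi>(1)] by (simp add: guided_def)
  ultimately show ?thesis unfolding limit_path_def f_def by (intro exI[of _ \<psi>]) blast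
qed

lemma limit_path_exists:
  assumes a: "is_limit r a" and S: "\<And>b. b \<prec> a \<Longrightarrow> spec G b (G b)" and u: "u \<in> Ul a"
  shows "\<exists>\<psi>. limit_path G a u \<psi>"
proof (cases "\<forall>b. b \<prec> a \<longrightarrow> (\<exists>c\<in>acc r (C a). b \<prec> c)")
  case True
  then show ?thesis using limit_path_acc[OF a S u] by blast
next
  case False
  then obtain b where b: "b \<prec> a" "\<And>d. d \<in> acc r (C a) \<Longrightarrow> \<not> b \<prec> d" by blast
  \<comment> \<open>\<open>s\<close> is the largest accumulation point of \<open>C a\<close>, or any
    point of \<open>C a\<close> if there is none. Starting the sequence at \<open>s\<close> secures
    agreement with the path at all accumulation points.\<close>
  obtain s where s: "s \<in> C a" "\<And>d. d \<in> acc r (C a) \<Longrightarrow> \<not> s \<prec> d"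
    "\<And>d. d \<in> acc r (C a) \<Longrightarrow> d = s \<or> d \<in> acc r (C s) \<and> is_limit r s"
  proof (cases "acc r (C a) = {}")
    case True
    with C_nonempty[OF a] that show thesis by blast
  next
    case False
    obtain s where s: "s \<in> acc r (C a)" "\<And>d. d \<in> acc r (C a) \<Longrightarrow> d \<preceq> s"
      using acc_bound[OF C_club[OF a] b False] by blast
    show thesis
    proof (rule that)
      show "s \<in> C a" using s(1) by (simp add: acc_def)
      fix d assume d: "d \<in> acc r (C a)"
      then show "\<not> s \<prec> d" using s(2) by (simp add: wo.not_less)
      show "d = s \<or> d \<in> acc r (C s) \<and> is_limit r s"
        using acc_coherent[OF d s(1)] s(2)[OF d] acc_limit[OF s(1)] C_coherent[OF s(1)]
        by (auto simp: wo.le_less)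
    qed
  qed
  obtain e :: "nat \<Rightarrow> 'k" where e: "e 0 = s" "\<And>n. e n \<in> C a" "\<And>m n. m < n \<Longrightarrow> e m \<prec> e n"
      "\<And>d. d \<prec> a \<Longrightarrow> \<exists>n. d \<prec> e n"
  proof (rule cofinal_sequence[OF C_club[OF a] s(1,2)])
    fix e :: "nat \<Rightarrow> 'k" assume "e 0 = s" "\<And>n. e n \<in> C a" "\<And>m n. m < n \<Longrightarrow> e m \<prec> e n"
      "\<And>d. d \<prec> a \<Longrightarrow> \<exists>n. d \<prec> e n"
    then show thesis by (rule that[of e])
  qed
  show ?thesis
    by (rule limit_path_sequence[OF a S u e(2-4)]) (use s(3) in \<open>simp_all add: e(1)\<close>)
qed


section \<open>The recursion: zero, successors and limits\<close>

lemma zero_neq_sc: "zero \<noteq> sc b"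
  by (metis lt_sc not_lt_zero)

lemma stage_zero: "\<exists>p. spec G zero p"
proof
  show "spec G zero ({Map.empty}, \<lambda>_ _. Map.empty)"
    using not_limit_zero by (auto simp: spec_def countable_le_M zero_neq_sc)
qed

lemma stage_sc:
  assumes s: "spec G b (G b)"
  shows "\<exists>p. spec G (sc b) p"
proof -
  \<comment> \<open>All of \<open>M b\<close> is available for the new value at \<open>b\<close>.
    This is room enough to give each pair \<open>(u, i)\<close> its own label, so the new path nodes
    differ whatever happened below.\<close>
  have "|Ul (sc b) \<times> (UNIV :: nat set)| \<le>o |M b|"
    by (rule Times_le_M[OF ordLeq_transitive[OF Ul_le_M M_sc_le] nat_le_M])
  then obtain h where h: "inj_on h (Ul (sc b) \<times> (UNIV :: nat set))" "h ` (Ul (sc b) \<times> UNIV) \<subseteq> M b"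
    by (metis card_of_ordLeq)
  define t where "t = (\<lambda>(x, i). x(b \<mapsto> i)) ` (fst (G b) \<times> M b)"
  define \<phi> where "\<phi> u i = (snd (G b) (res u b) i)(b \<mapsto> h (u, i))" for u i
  have resb: "res (x(b \<mapsto> i)) c = res x c" if "c \<prec> sc b" for x :: "'k node" and i c
    using that by (auto simp: restrict_map_def fun_eq_iff lt_sc_iff wo.not_less)
  have ub: "res u b \<in> Ul b" if "u \<in> Ul (sc b)" for u
    by (rule Ul_res[OF that]) (simp add: wo.less_imp_le)
  have inner: "dom y = underS r (sc b) \<and> (\<forall>c. c \<prec> sc b \<longrightarrow> res y c \<in> fst (G c))" if "y \<in> t" for y
  proof -
    obtain x i where y: "y = x(b \<mapsto> i)" "x \<in> fst (G b)" using \<open>y \<in> t\<close> by (auto simp: t_def)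
    then show ?thesis using spec_dom[OF s] spec_res[OF s] resb by (simp add: underS_sc lt_sc_iff)
  qed
  have nonempty: "t \<noteq> {}" using spec_nonempty[OF s] M_infinite[of b] by (auto simp: t_def)
  have normal: "\<exists>y\<in>t. res y c = x" if c: "c \<prec> sc b" and x: "x \<in> fst (G c)" for c x
  proof -
    obtain z where z: "z \<in> fst (G b)" "res z c = x"
      using spec_normal[OF s _ x] c by (auto simp: lt_sc_iff)
    obtain i where "i \<in> M b" using M_infinite[of b] by fastforce
    with z have "z(b \<mapsto> i) \<in> t" by (auto simp: t_def)
    with z(2) resb[OF c] show ?thesis by metis
  qed
  have card: "|t| \<le>o |M (sc b)|"
  proof -
    have "|t| \<le>o |fst (G b) \<times> M b|" unfolding t_def by (rule card_of_image)
    also have "|fst (G b) \<times> M b| \<le>o |M b|"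
      by (rule Times_le_M[OF spec_card[OF s] card_of_mono1[OF subset_refl]])
    also have "|M b| \<le>o |M (sc b)|" by (rule M_mono) (simp add: wo.less_imp_le)
    finally show ?thesis .
  qed
  have inj: "inj_on (\<lambda>(u, i). \<phi> u i) (Ul (sc b) \<times> UNIV)"
  proof (rule inj_onI)
    fix p q assume p: "p \<in> Ul (sc b) \<times> UNIV" and q: "q \<in> Ul (sc b) \<times> UNIV"
      and eq: "(\<lambda>(u, i). \<phi> u i) p = (\<lambda>(u, i). \<phi> u i) q"
    then have "h p = h q"
      by (auto simp: \<phi>_def split: prod.splits dest!: fun_cong[of _ _ b])
    then show "p = q" using inj_onD[OF h(1) _ p q] by blast
  qed
  have path: "\<phi> u i \<in> t" if "u \<in> Ul (sc b)" for u i
  proof -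
    have "(snd (G b) (res u b) i, h (u, i)) \<in> fst (G b) \<times> M b"
      using spec_path[OF s ub[OF that]] h(2) that by blast
    then show ?thesis unfolding t_def \<phi>_def by (rule rev_image_eqI) simp
  qed
  have fin: "finite {i. res (\<phi> u i) c \<noteq> snd (G c) (res u c) i}" if "u \<in> Ul (sc b)" "c \<prec> sc b" for u c
  proof (cases "c = b")
    case True
    have "dom (snd (G b) (res u b) i) = underS r b" for i
      using spec_dom[OF s spec_path[OF s ub[OF that(1)]]] .
    then have "res (\<phi> u i) b = snd (G b) (res u b) i" for i
      unfolding \<phi>_def by (simp only: resb[OF lt_sc] res_self)
    then show ?thesis using True by simp
  next
    case False
    then have "c \<prec> b" using that(2) by (simp add: lt_sc_iff wo.le_less)
    then have "finite {i. res (snd (G b) (res u b) i) c \<noteq> snd (G c) (res (res u b) c) i}"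
      using spec_finite[OF s ub[OF that(1)]] by blast
    then show ?thesis using \<open>c \<prec> b\<close> unfolding \<phi>_def by (simp only: resb[OF that(2)] res_res wo.less_imp_le)
  qed
  have "spec G (sc b) (t, \<phi>)"
    unfolding spec_def prod.case
    using inner nonempty normal card inj path fin not_limit_sc by (simp add: t_def[symmetric])
  then show ?thesis by blast
qed

text \<open>The level consists of all guided walks and all path nodes, at most \<open>|M a|\<close>
  of either kind. For normality a node is first lifted to a level in \<open>C a\<close> and then
  continued by a guided walk.\<close>

lemma stage_limit:
  assumes a: "is_limit r a" and S: "\<And>b. b \<prec> a \<Longrightarrow> spec G b (G b)"
  shows "\<exists>p. spec G a p"
proof -
  define g where "g = {y. \<exists>b0\<in>C a. guided G (C a) b0 y a}"
  have "\<forall>u\<in>Ul a. \<exists>\<psi>. limit_path G a u \<psi>" using limit_path_exists[OF a S] by blast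
  from bchoice[OF this] obtain \<phi> where \<phi>: "\<And>u. u \<in> Ul a \<Longrightarrow> limit_path G a u (\<phi> u)" by blast
  define t where "t = g \<union> (\<lambda>(u, i). \<phi> u i) ` (Ul a \<times> UNIV)"
  have t_cases: "(\<exists>b0\<in>C a. guided G (C a) b0 y a) \<or> (\<exists>u\<in>Ul a. \<exists>i. y = \<phi> u i)" if "y \<in> t" for y
    using that by (auto simp: t_def g_def)
  have inner: "dom y = underS r a \<and> (\<forall>b. b \<prec> a \<longrightarrow> res y b \<in> fst (G b))" if "y \<in> t" for y
    using t_cases[OF that]
  proof (elim disjE bexE exE)
    show ?thesis if "u \<in> Ul a" "y = \<phi> u i" for u i
      using \<phi>[OF that(1)] that(2) by (simp add: limit_path_def)
  qed (simp add: guided_def)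
  have seal: "sealed G a y" if "y \<in> t" for y
    using t_cases[OF that] guided_sealed[OF a] \<phi> by (auto simp: limit_path_def)
  have normal: "\<exists>y\<in>t. res y b = x" if b: "b \<prec> a" and x: "x \<in> fst (G b)" for b x
  proof -
    obtain c where c: "c \<in> C a" "b \<prec> c" using club_in_unbounded[OF C_club[OF a] b] by blast
    obtain z where z: "z \<in> fst (G c)" "res z b = x"
      using spec_normal[OF S[OF C_lt[OF a c(1)]] wo.less_imp_le[OF c(2)] x] by blast
    obtain y where y: "guided G (C a) c y a" "res y c = z"
      using guided_exists[OF a S c(1) z(1)] .
    then have "y \<in> t" using c(1) by (auto simp: t_def g_def)
    moreover have "res y b = x" using y(2) z(2) c(2) by (metis res_res wo.less_imp_le)
    ultimately show ?thesis by blast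
  qed
  have nonempty: "t \<noteq> {}"
  proof -
    have "zero \<prec> a" using limit_gt_zero[OF a] .
    then obtain x where "x \<in> fst (G zero)" using spec_nonempty[OF S] by blast
    with normal[OF \<open>zero \<prec> a\<close>] show ?thesis by blast
  qed
  have card: "|t| \<le>o |M a|"
    unfolding t_def
  proof (rule Un_le_M)
    show "|g| \<le>o |M a|" unfolding g_def by (rule card_guided[OF a S])
    show "|(\<lambda>(u, i). \<phi> u i) ` (Ul a \<times> UNIV)| \<le>o |M a|"
      by (rule ordLeq_transitive[OF card_of_image Times_le_M[OF Ul_le_M nat_le_M]])
  qed
  have "spec G a (t, \<phi>)"
    unfolding spec_def prod.case
  proof (intro conjI)
    show "is_limit r a \<longrightarrow> (\<forall>b0\<in>C a. \<forall>y. guided G (C a) b0 y a \<longrightarrow> y \<in> t) \<and> (\<forall>y\<in>t. sealed G a y) \<and>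
       (\<forall>c\<in>acc r (C a). \<forall>u\<in>Ul a. \<forall>i. res (\<phi> u i) c = snd (G c) (res u c) i)"
      using seal \<phi> by (auto simp: limit_path_def t_def g_def)
    show "\<forall>b. a = sc b \<longrightarrow> t = (\<lambda>(x, i). x(b \<mapsto> i)) ` (fst (G b) \<times> M b) \<and>
       inj_on (\<lambda>(u, i). \<phi> u i) (Ul a \<times> UNIV)" using a not_limit_sc by blast
    show "\<forall>u\<in>Ul a. \<forall>i. \<phi> u i \<in> t" by (auto simp: t_def)
    show "\<forall>u\<in>Ul a. \<forall>b. b \<prec> a \<longrightarrow> finite {i. res (\<phi> u i) b \<noteq> snd (G b) (res u b) i}"
      using \<phi> by (simp add: limit_path_def)
  qed (use inner nonempty normal card in blast)+
  then show ?thesis by blast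
qed

lemma stages_exist: "\<exists>G. \<forall>a. spec G a (G a)"
proof (rule dependent_wf_choice[OF wf_lt])
  show "spec f a p = spec g a p" if "\<And>z. (z, a) \<in> {(a, b). a \<prec> b} \<Longrightarrow> f z = g z" for f g a p
    by (rule spec_cong) (use that in simp)
  show "\<exists>p. spec f a p" if *: "\<And>y. (y, a) \<in> {(a, b). a \<prec> b} \<Longrightarrow> spec f y (f y)" for a f
  proof -
    have S: "\<And>y. y \<prec> a \<Longrightarrow> spec f y (f y)" using * by simp
    show ?thesis
      by (cases a rule: ord_cases) (use stage_zero stage_sc[OF S] stage_limit[OF _ S] in simp_all)
  qed
qed

end

section \<open>The tree and its ascent path\<close>

locale slim_stages = slim_construction r U C A pr
  for r :: "'k rel" and U C A pr +
  fixes G :: "'k \<Rightarrow> 'k stage"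
  assumes S: "\<And>a. spec G a (G a)"
begin

definition T :: "'k node set" where "T = (\<Union>a. fst (G a))"

lemma level_T: "level r T a = fst (G a)"
proof -
  have "x \<in> fst (G a)" if "x \<in> fst (G b)" "dom x = underS r a" for x b
    using spec_dom[OF S that(1)] that underS_inject[of a b] by simp
  then show ?thesis unfolding level_def T_def using spec_dom[OF S] by blast
qed

lemma T_cases: "x \<in> T \<Longrightarrow> \<exists>a. x \<in> fst (G a)"
  by (auto simp: T_def)

lemma T_downward_closed: "downward_closed r T"
  unfolding downward_closed_def
proof (intro conjI ballI allI impI)
  fix x assume "x \<in> T"
  then obtain a where a: "x \<in> fst (G a)" using T_cases by blast
  have dx: "dom x = underS r a" using spec_dom[OF S a] .
  then show "is_node r x" by (auto simp: is_node_def)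
  fix y assume y: "is_node r y \<and> y \<subseteq>\<^sub>m x"
  then obtain b where b: "dom y = underS r b" by (auto simp: is_node_def)
  then have "y = res x b" using map_le_iff_res y by metis
  have "underS r b \<subseteq> underS r a" using y b dx map_le_implies_dom_le by metis
  then have "b \<preceq> a" by (metis mem_underS subsetD wo.less_irrefl wo.not_le)
  then show "y \<in> T" using spec_res[OF S a] \<open>y = res x b\<close> by (auto simp: T_def)
qed

lemma T_prolific: "prolific r T"
  unfolding prolific_def level_T
proof (intro allI ballI impI)
  fix a x i assume x: "x \<in> fst (G a)" and i: "i \<prec> om \<or> i \<prec> a"
  then have "x(a \<mapsto> i) \<in> fst (G (sc a))"
    unfolding spec_sc[OF S refl] M_def by (auto intro!: rev_image_eqI[of "(x, i)"])
  then show "x(a \<mapsto> i) \<in> T" by (auto simp: T_def)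
qed

lemma T_slim: "slim r T"
  unfolding slim_iff level_T using spec_card[OF S] by blast

lemma card_level: "|fst (G a)| <o r"
  using spec_card[OF S] M_less ordLeq_ordLess_trans by blast

lemma T_tree: "kappa_tree r T"
  unfolding kappa_tree_def level_T using spec_nonempty[OF S] card_level by blast

section \<open>Sealing of dense sets and the Souslin property\<close>

lemma enc_inj: "inj_on (enc (fst (G a))) (fst (G a))"
proof -
  have "|fst (G a)| \<le>o |UNIV :: 'k set|"
    using card_level card_UNIV ordIso_symmetric ordLess_imp_ordLeq ordLeq_ordIso_trans by blast
  then have "\<exists>e :: 'k node \<Rightarrow> 'k. inj_on e (fst (G a))" by (meson card_of_ordLeq)
  then show ?thesis unfolding enc_def by (rule someI_ex)
qed

text \<open>On a suitable level \<open>a\<close>, every node makes a prescribed step into a point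
  where diamond guesses \<open>D\<close> correctly. Density offered an extension through
  \<open>D\<close> at that step, so the step took such an extension.\<close>

lemma sealed_dense:
  assumes D: "D \<subseteq> T" and dense: "\<And>x. x \<in> T \<Longrightarrow> \<exists>y\<in>D. x \<subseteq>\<^sub>m y"
  shows "\<exists>a. \<forall>y\<in>fst (G a). \<exists>g. g \<prec> a \<and> res y g \<in> D"
proof -
  define code where "code g x = pr (g, enc (fst (G g)) x)" for g x
  define X where "X = {code g x | g x. x \<in> fst (G g) \<and> x \<in> D}"
  have codeX: "code g x \<in> X \<longleftrightarrow> x \<in> D" if "x \<in> fst (G g)" for g x
  proof
    assume "code g x \<in> X"
    then obtain g' x' where "code g x = code g' x'" "x' \<in> fst (G g')" "x' \<in> D"
      by (auto simp: X_def)
    moreover from this(1) have "g = g'" "enc (fst (G g)) x = enc (fst (G g')) x'"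
      using injD[OF inj_pr] unfolding code_def by blast+
    ultimately show "x \<in> D" using inj_onD[OF enc_inj _ that] by metis
  qed (use that in \<open>auto simp: X_def\<close>)
  \<comment> \<open>\<open>h\<close> is the level of an element of \<open>D\<close> above
    \<open>x\<close>; a point closed under these heights leaves room for that element below
    it.\<close>
  have "\<forall>x\<in>fst (G g). \<exists>h. \<exists>w\<in>fst (G h). w \<in> D \<and> res w g = x \<and> g \<preceq> h" for g
  proof
    fix x assume x: "x \<in> fst (G g)"
    then have "x \<in> T" by (auto simp: T_def)
    from dense[OF this] obtain w where w: "w \<in> D" "x \<subseteq>\<^sub>m w" by blast
    then obtain h where h: "w \<in> fst (G h)" using D T_cases by blast
    have "underS r g \<subseteq> underS r h"
      using map_le_implies_dom_le[OF w(2)] spec_dom[OF S x] spec_dom[OF S h] by simp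
    then have "g \<preceq> h" by (metis mem_underS subsetD wo.less_irrefl wo.not_le)
    moreover have "res w g = x" using w(2) map_le_iff_res[OF spec_dom[OF S x]] by blast
    ultimately show "\<exists>h. \<exists>w\<in>fst (G h). w \<in> D \<and> res w g = x \<and> g \<preceq> h" using w(1) h by blast
  qed
  then obtain ht where ht: "\<And>g x. x \<in> fst (G g) \<Longrightarrow>
      \<exists>w\<in>fst (G (ht g x)). w \<in> D \<and> res w g = x \<and> g \<preceq> ht g x" by metis
  have "\<forall>g. \<exists>b. \<forall>x\<in>fst (G g). code g x \<prec> b" "\<forall>g. \<exists>b. \<forall>x\<in>fst (G g). ht g x \<prec> b"
    using bounded_image[OF card_level] by blast+
  then obtain k1 k2 where k1: "\<And>g x. x \<in> fst (G g) \<Longrightarrow> code g x \<prec> k1 g"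
    and k2: "\<And>g x. x \<in> fst (G g) \<Longrightarrow> ht g x \<prec> k2 g" by metis
  define k where "k g = (if k1 g \<preceq> k2 g then k2 g else k1 g)" for g
  have k: "code g x \<prec> k g" "ht g x \<prec> k g" if "x \<in> fst (G g)" for g x
    using k1[OF that] k2[OF that] by (auto simp: k_def wo.not_le intro: wo.less_le_trans wo.less_trans)
  \<comment> \<open>Correct guesses at points closed under \<open>k\<close>, which bounds both the
    codes of the nodes on a level and the heights of their extensions in \<open>D\<close>.\<close>
  define B where "B = {b. X \<inter> underS r b = A b \<and> (\<forall>g. g \<prec> b \<longrightarrow> k g \<prec> b)}"
  have "cofinal B r"
    unfolding cofinal_def Field
  proof
    fix a
    show "\<exists>b\<in>B. a \<noteq> b \<and> (a, b) \<in> r"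
    proof (rule stationary_closure_point[OF A_guess[of X], of a k])
      fix c assume "c \<in> {b. X \<inter> underS r b = A b}" "a \<prec> c" "\<And>g. g \<prec> c \<Longrightarrow> k g \<prec> c"
      then show ?thesis by (intro bexI[of _ c]) (auto simp: B_def ord_lt_def underS_def)
    qed
  qed
  then obtain a where a: "is_limit r a" "is_sup r {b\<in>C a. succ_omega r {c\<in>C a. b \<preceq> c} \<subseteq> B} a"
    using stationary_closure_point[OF C_hits] by blast
  \<comment> \<open>Nodes on levels below \<open>c\<close> have codes below \<open>c\<close>, so at
    a point \<open>c\<close> of \<open>B\<close> the guess \<open>A c\<close> decides correctly
    which of them belong to \<open>D\<close>.\<close>
  have hitsD: "hits G c z \<longleftrightarrow> (\<exists>g. g \<prec> c \<and> res z g \<in> fst (G g) \<and> res z g \<in> D)" if c: "c \<in> B" for c z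
  proof -
    have "res z g \<in> guess G c g \<longleftrightarrow> res z g \<in> fst (G g) \<and> res z g \<in> D" if g: "g \<prec> c" for g
    proof (cases "res z g \<in> fst (G g)")
      case True
      have "code g (res z g) \<prec> c" using k(1)[OF True] c g wo.less_trans unfolding B_def by blast
      then have "code g (res z g) \<in> A c \<longleftrightarrow> code g (res z g) \<in> X" using c by (auto simp: B_def)
      then show ?thesis using True codeX[OF True] by (simp add: guess_def code_def)
    qed (simp add: guess_def)
    then show ?thesis unfolding hits_def by blast
  qed
  have "\<exists>g. g \<prec> a \<and> res y g \<in> D" if y: "y \<in> fst (G a)" for y
  proof -
    obtain b1 where b1: "b1 \<in> C a" and seal: "\<And>b. b \<in> C a \<Longrightarrow> b1 \<preceq> b \<Longrightarrow> \<exists>p c. consec (C a) p c \<and> b \<preceq> p \<and>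
      c \<in> succ_omega r {d\<in>C a. b \<preceq> d} \<and> res y c = step G c p (res y p)"
      using spec_sealed[OF S a(1) y] unfolding sealed_def by blast
    \<comment> \<open>The hitting hypothesis gives a \<open>b\<close> beyond \<open>b1\<close> whose
      next \<omega> points in \<open>C a\<close> all lie in \<open>B\<close>; sealing at
      \<open>b\<close> then finds a step arriving at one of them.\<close>
    obtain b where b: "b \<in> C a" "succ_omega r {c\<in>C a. b \<preceq> c} \<subseteq> B" "b1 \<prec> b"
      using a(2) C_lt[OF a(1) b1] unfolding is_sup_def by blast
    obtain p c where pc: "consec (C a) p c" "c \<in> B" "res y c = step G c p (res y p)"
      using seal[OF b(1) wo.less_imp_le[OF b(3)]] b(2) by blast
    have lt: "p \<prec> c" "c \<prec> a" "p \<prec> a" using pc(1) C_lt[OF a(1)] by (auto simp: consec_def)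
    have yp: "res y p \<in> fst (G p)" using spec_res[OF S y] lt(3) by (simp add: wo.less_imp_le)
    let ?h = "ht p (res y p)"
    obtain w where w: "w \<in> fst (G ?h)" "w \<in> D" "res w p = res y p" "p \<preceq> ?h"
      using ht[OF yp] by blast
    \<comment> \<open>The element of \<open>D\<close> above \<open>res y p\<close> lives below level
      \<open>c\<close>, so it has an extension on level \<open>c\<close> that hits; hence the step
      chose a hitting node as well.\<close>
    have hc: "?h \<prec> c" using k(2)[OF yp] pc(2) lt(1) wo.less_trans unfolding B_def by blast
    obtain z where z: "z \<in> fst (G c)" "res z ?h = w"
      using spec_normal[OF S wo.less_imp_le[OF hc] w(1)] by blast
    have "hits G c z" unfolding hitsD[OF pc(2)] using z(2) w hc by blast
    moreover have "res z p = res y p" using z(2) w(3,4) by (metis res_res)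
    ultimately have "hits G c (res y c)"
      using step_hits[OF S wo.less_imp_le[OF lt(1)] yp] z(1) pc(3) by metis
    then obtain g where "g \<prec> c" "res (res y c) g \<in> D" unfolding hitsD[OF pc(2)] by blast
    then show ?thesis using lt(2) by (intro exI[of _ g]) (auto simp: wo.less_imp_le dest: wo.less_trans)
  qed
  then show ?thesis by blast
qed

lemma T_comparable_eq:
  assumes "x \<in> fst (G a)" "y \<in> fst (G a)" "x \<subseteq>\<^sub>m y" shows "x = y"
  using assms spec_dom[OF S] map_le_iff_res res_self by metis

text \<open>The complement of a branch is dense, since every node has two distinct immediate
  successors and a chain contains at most one of them. So the branch's node on the level from
  \<open>sealed_dense\<close> would have a restriction off the branch, although the branch meets
  every level and is a chain.\<close>

lemma T_no_branch: "\<not> cofinal_branch r T B"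
proof
  assume B: "cofinal_branch r T B"
  have chain: "\<And>x y. x \<in> B \<Longrightarrow> y \<in> B \<Longrightarrow> x \<subseteq>\<^sub>m y \<or> y \<subseteq>\<^sub>m x"
    using B by (simp add: cofinal_branch_def tree_chain_def)
  have "\<forall>a. B \<inter> fst (G a) \<noteq> {}" using B by (simp add: cofinal_branch_def level_T)
  then have meets: "\<exists>x\<in>B. x \<in> fst (G a)" for a by blast
  have "\<exists>y\<in>T - B. x \<subseteq>\<^sub>m y" if x: "x \<in> T" for x
  proof -
    obtain a where a: "x \<in> fst (G a)" using T_cases[OF x] by blast
    obtain i where i: "i \<in> M a" using M_infinite[of a] by fastforce
    obtain j where j: "j \<in> M a" "j \<noteq> i" using M_infinite[of a] i
      by (metis finite.simps insert_iff ex_in_conv finite_subset subsetI)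
    have ext: "x(a \<mapsto> l) \<in> fst (G (sc a)) \<and> x \<subseteq>\<^sub>m x(a \<mapsto> l)" if "l \<in> M a" for l
      unfolding spec_sc[OF S refl] using a that spec_dom[OF S a]
      by (auto intro!: rev_image_eqI[of "(x, l)"] simp: map_le_def)
    have "\<not> (x(a \<mapsto> i) \<in> B \<and> x(a \<mapsto> j) \<in> B)"
    proof
      assume "x(a \<mapsto> i) \<in> B \<and> x(a \<mapsto> j) \<in> B"
      then have "x(a \<mapsto> i) = x(a \<mapsto> j)"
        using chain T_comparable_eq ext[OF i] ext[OF j(1)] by metis
      then show False using j(2) by (metis fun_upd_same option.inject)
    qed
    moreover have "x(a \<mapsto> l) \<in> T" if "l \<in> M a" for l using ext[OF that] by (auto simp: T_def)
    ultimately show ?thesis using ext i j(1) by blast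
  qed
  then obtain a where a: "\<And>y. y \<in> fst (G a) \<Longrightarrow> \<exists>g. g \<prec> a \<and> res y g \<in> T - B"
    using sealed_dense[of "T - B"] by blast
  obtain y where y: "y \<in> B" "y \<in> fst (G a)" using meets by blast
  obtain g where g: "g \<prec> a" "res y g \<notin> B" using a[OF y(2)] by blast
  obtain d where d: "d \<in> B" "d \<in> fst (G g)" using meets by blast
  have "d \<subseteq>\<^sub>m y"
  proof (rule ccontr)
    assume "\<not> d \<subseteq>\<^sub>m y"
    then have "y \<subseteq>\<^sub>m d" using chain[OF y(1) d(1)] by blast
    then have "underS r a \<subseteq> underS r g"
      using map_le_implies_dom_le spec_dom[OF S y(2)] spec_dom[OF S d(2)] by metis
    then show False using g(1) by (metis mem_underS subsetD wo.less_irrefl)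
  qed
  then have "res y g = d" using map_le_iff_res spec_dom[OF S d(2)] by metis
  with g(2) d(1) show False by simp
qed

text \<open>Let \<open>a\<close> be the level from \<open>sealed_dense\<close>. An element
  \<open>z\<close> of \<open>Z\<close> at height \<open>a\<close> or more has a proper restriction
  in \<open>D\<close>; as this restriction lies below \<open>z\<close>, it must extend an element of
  \<open>Z\<close>. That element can only be \<open>z\<close>, which does not fit below its own
  proper restriction.\<close>

lemma T_antichain_bounded:
  assumes "antichain T Z"
  obtains a where "Z \<subseteq> (\<Union>b\<in>underS r a. fst (G b))"
proof -
  have Z: "Z \<subseteq> T" "\<And>x y. x \<in> Z \<Longrightarrow> y \<in> Z \<Longrightarrow> x \<subseteq>\<^sub>m y \<Longrightarrow> x = y"
    using assms unfolding antichain_def strict_ext_def by blast+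
  \<comment> \<open>The first alternative covers extensions of nodes that lie below an element of
    \<open>Z\<close>; all other nodes satisfy the second alternative themselves.\<close>
  define D where "D = {x\<in>T. (\<exists>z\<in>Z. z \<subseteq>\<^sub>m x) \<or> (\<forall>z\<in>Z. \<not> x \<subseteq>\<^sub>m z)}"
  have "\<exists>y\<in>D. x \<subseteq>\<^sub>m y" if "x \<in> T" for x
  proof (cases "\<exists>z\<in>Z. x \<subseteq>\<^sub>m z")
    case True
    then obtain z where "z \<in> Z" "x \<subseteq>\<^sub>m z" by blast
    moreover from this have "z \<in> D" using Z(1) map_le_refl unfolding D_def by blast
    ultimately show ?thesis by blast
  next
    case False
    then have "x \<in> D" using that by (simp add: D_def)
    then show ?thesis using map_le_refl by blast
  qed
  then obtain a where a: "\<And>y. y \<in> fst (G a) \<Longrightarrow> \<exists>g. g \<prec> a \<and> res y g \<in> D"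
    using sealed_dense[of D] unfolding D_def by blast
  have "z \<in> (\<Union>b\<in>underS r a. fst (G b))" if z: "z \<in> Z" for z
  proof -
    obtain b where b: "z \<in> fst (G b)" using T_cases z Z(1) by blast
    have "b \<prec> a"
    proof (rule ccontr)
      assume "\<not> b \<prec> a"
      then have "a \<preceq> b" by (simp add: wo.not_less)
      then obtain g where g: "g \<prec> a" "res (res z a) g \<in> D" using a spec_res[OF S b] by blast
      then have gD: "res z g \<in> D" by (simp add: wo.less_imp_le)
      have gb: "g \<prec> b" using g(1) \<open>a \<preceq> b\<close> wo.less_le_trans by blast
      have sub: "res z g \<subseteq>\<^sub>m z" by (simp add: map_le_def)
      then obtain z' where z': "z' \<in> Z" "z' \<subseteq>\<^sub>m res z g" using gD z unfolding D_def by blast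
      then have "z' = z" using Z(2)[OF z'(1) z] map_le_trans[OF z'(2) sub] by blast
      with z'(2) have "dom z \<subseteq> dom (res z g)" using map_le_implies_dom_le by blast
      then show False using gb spec_dom[OF S b] by auto
    qed
    with b show ?thesis by auto
  qed
  with that show thesis by blast
qed

lemma T_souslin: "souslin r T"
  unfolding souslin_def
proof (intro conjI T_tree notI)
  show False if "\<exists>B. cofinal_branch r T B" using that T_no_branch by blast
  assume "\<exists>Z. antichain T Z \<and> |Z| =o r"
  then obtain Z where Z: "antichain T Z" "|Z| =o r" by blast
  obtain a where a: "Z \<subseteq> (\<Union>b\<in>underS r a. fst (G b))" using T_antichain_bounded[OF Z(1)] .
  \<comment> \<open>An antichain lies in the levels below \<open>a\<close>, and slimness bounds
    their union by \<open>|M a|\<close>, which is less than \<kappa>.\<close>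
  have "|\<Union>b\<in>underS r a. fst (G b)| \<le>o |M a|"
  proof (rule card_of_UNION_ordLeq_infinite[OF M_infinite underS_le_M])
    show "\<forall>b\<in>underS r a. |fst (G b)| \<le>o |M a|"
    proof
      fix b assume "b \<in> underS r a"
      then have "|M b| \<le>o |M a|" by (intro M_mono) (simp add: wo.less_imp_le)
      with spec_card[OF S, of b] show "|fst (G b)| \<le>o |M a|" by (rule ordLeq_transitive)
    qed
  qed
  with a have "|Z| \<le>o |M a|" using card_of_mono1 ordLeq_transitive by blast
  then have "|Z| <o r" using M_less ordLeq_ordLess_trans by blast
  with Z(2) show False using not_ordLess_ordIso by blast
qed

section \<open>The ascent path\<close>

definition ascent :: "'k node \<Rightarrow> nat \<Rightarrow> 'k node" where
  "ascent u = snd (G (THE a. dom u = underS r a)) u"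

lemma ascent_eq: "u \<in> Ul a \<Longrightarrow> ascent u = snd (G a) u"
proof -
  assume "u \<in> Ul a"
  then have "(THE b. dom u = underS r b) = a" using dom_Ul underS_inject by (intro the_equality) auto
  then show ?thesis by (simp add: ascent_def)
qed

lemma ascent_finite:
  assumes u: "u \<in> Ul a" and b: "b \<preceq> a"
  shows "finite {i. res (ascent u i) b \<noteq> ascent (res u b) i}"
proof (cases "b = a")
  case True
  then show ?thesis using ascent_eq[OF u] spec_dom[OF S spec_path[OF S u]] dom_Ul[OF u] by simp
next
  case False
  with b have "b \<prec> a" by (simp add: wo.le_less)
  then show ?thesis using spec_finite[OF S u] ascent_eq[OF u] ascent_eq[OF Ul_res[OF u b]] by simp
qed

lemma U_cases:
  assumes "u \<in> U" shows "\<exists>a. u \<in> Ul a"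
proof -
  have "is_node r u" using U_closed assms unfolding downward_closed_def by blast
  with assms show ?thesis by (auto simp: is_node_def level_def)
qed

lemma ascent_T: "u \<in> Ul a \<Longrightarrow> ascent u i \<in> fst (G a)"
  using ascent_eq spec_path[OF S] by simp

lemma ascent_inj: "u \<in> Ul (sc b) \<Longrightarrow> v \<in> Ul (sc b) \<Longrightarrow> ascent u i = ascent v j \<longleftrightarrow> u = v \<and> i = j"
  using inj_onD[OF spec_inj[OF S refl], of b "(u, i)" "(v, j)"] by (auto simp: ascent_eq)

lemma ascent_is_path: "ascent_path r Ffin U T ascent"
  unfolding ascent_path_def
proof (intro conjI ballI allI impI)
  fix u i assume "u \<in> U"
  then obtain a where a: "u \<in> Ul a" using U_cases by blast
  show "ascent u i \<in> T" using ascent_T[OF a] by (auto simp: T_def)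
  show "dom (ascent u i) = dom u" using spec_dom[OF S ascent_T[OF a]] dom_Ul[OF a] by simp
next
  fix u v assume U: "u \<in> U" "v \<in> U" and uv: "strict_ext u v"
  obtain a b where a: "u \<in> Ul a" and b: "v \<in> Ul b" using U_cases[OF U(1)] U_cases[OF U(2)] by blast
  have u: "res v a = u" using map_le_iff_res[OF dom_Ul[OF a]] uv by (auto simp: strict_ext_def)
  have "\<not> b \<preceq> a"
  proof
    assume "b \<preceq> a"
    then have "res v a = v" using dom_Ul[OF b]
      by (intro ext) (metis domIff mem_underS restrict_in restrict_out wo.less_le_trans)
    with u uv show False by (simp add: strict_ext_def)
  qed
  then have ab: "a \<prec> b" by simp
  have "strict_ext (ascent u i) (ascent v i)" if "res (ascent v i) a = ascent u i" for i
  proof -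
    have "ascent u i \<subseteq>\<^sub>m ascent v i" using map_le_iff_res[OF spec_dom[OF S ascent_T[OF a]]] that by blast
    moreover have "ascent u i \<noteq> ascent v i"
      using spec_dom[OF S ascent_T[OF a, of i]] spec_dom[OF S ascent_T[OF b, of i]] ab underS_inject[of a b]
      by auto
    ultimately show ?thesis by (simp add: strict_ext_def)
  qed
  then have "UNIV - {i. strict_ext (ascent u i) (ascent v i)} \<subseteq> {i. res (ascent v i) a \<noteq> ascent (res v a) i}"
    using u by auto
  then show "{i. strict_ext (ascent u i) (ascent v i)} \<in> Ffin"
    using ascent_finite[OF b wo.less_imp_le[OF ab]] finite_subset by (simp add: Ffin_def)
next
  fix u v assume U: "u \<in> U" "v \<in> U" and uv: "u \<noteq> v \<and> dom u = dom v"
  obtain a b where a: "u \<in> Ul a" and b: "v \<in> Ul b" using U_cases[OF U(1)] U_cases[OF U(2)] by blast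
  have "b = a" using dom_Ul[OF a] dom_Ul[OF b] uv underS_inject[of b a] by simp
  obtain c where c: "u c \<noteq> v c" using uv by blast
  have "c \<prec> a"
  proof (rule ccontr)
    assume "\<not> c \<prec> a"
    then have "c \<notin> dom u" "c \<notin> dom v" using dom_Ul[OF a] uv by simp_all
    with c show False by (simp add: domIff)
  qed
  \<comment> \<open>On the successor level \<open>sc c\<close> the restrictions of \<open>u\<close>
    and \<open>v\<close> already differ, and there the path nodes differ for every \<open>i\<close>.
    Since the nodes on level \<open>a\<close> extend these for almost all \<open>i\<close>, the
    difference persists almost everywhere.\<close>
  then have le: "sc c \<preceq> a" by simp
  have ne: "res u (sc c) \<noteq> res v (sc c)" using c lt_sc by (metis mem_underS restrict_in)
  have "ascent (res u (sc c)) i \<noteq> ascent (res v (sc c)) i" for i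
    using ascent_inj[OF Ul_res[OF a le] Ul_res[OF b], of i i] le ne \<open>b = a\<close> by simp
  then have "UNIV - {i. ascent u i \<noteq> ascent v i} \<subseteq>
      {i. res (ascent u i) (sc c) \<noteq> ascent (res u (sc c)) i} \<union> {i. res (ascent v i) (sc c) \<noteq> ascent (res v (sc c)) i}"
  proof (intro subsetI)
    fix i assume "i \<in> UNIV - {i. ascent u i \<noteq> ascent v i}"
    then have "ascent u i = ascent v i" by simp
    with \<open>\<And>i. ascent (res u (sc c)) i \<noteq> ascent (res v (sc c)) i\<close>[of i]
    show "i \<in> {i. res (ascent u i) (sc c) \<noteq> ascent (res u (sc c)) i} \<union> {i. res (ascent v i) (sc c) \<noteq> ascent (res v (sc c)) i}"
      by auto
  qed
  moreover have "finite \<dots>" using ascent_finite[OF a le] ascent_finite[OF b] le \<open>b = a\<close> by simp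
  ultimately have "finite (UNIV - {i. ascent u i \<noteq> ascent v i})" by (rule finite_subset)
  then show "{i. ascent u i \<noteq> ascent v i} \<in> Ffin" by (simp add: Ffin_def)
qed

lemma ascent_injective: "injective_ascent_path r Ffin U T ascent"
  unfolding injective_ascent_path_def
proof (intro conjI ascent_is_path allI impI)
  fix b :: "'k \<Rightarrow> 'k" assume b: "\<forall>a. restr_seq r b a \<in> U"
  \<comment> \<open>Height one is a successor level, where the path is injective in \<open>i\<close>
    throughout, so all of \<omega> serves as \<open>I\<close>.\<close>
  let ?u = "restr_seq r b (sc zero)"
  have "?u \<in> Ul (sc zero)" using b by (auto simp: level_def restr_seq_def dom_def)
  then have "inj_on (ascent ?u) UNIV" using ascent_inj by (auto simp: inj_on_def)
  moreover have "UNIV \<in> Ffin" by (simp add: Ffin_def)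
  ultimately show "\<exists>a. \<exists>I\<in>Ffin. inj_on (ascent (restr_seq r b a)) I" by blast
qed

end

theorem theorem4p2:
  fixes r :: "'k rel" and U :: "('k \<rightharpoonup> 'k) set"
  assumes "regular_uncountable r"
    and "downward_closed r U" and "slim r U" and "kappa_tree r U"
    and "P14 r"
  shows "\<exists>T :: ('k \<rightharpoonup> 'k) set. downward_closed r T \<and> prolific r T \<and> slim r T \<and> souslin r T
           \<and> (\<exists>f. injective_ascent_path r Ffin U T f)"
proof -
  interpret reg_card r by standard fact
  obtain pr :: "'k \<times> 'k \<Rightarrow> 'k" where pr: "inj pr" using ex_pairing by blast
  obtain A where A: "\<And>X. stationary r {a. X \<inter> underS r a = A a}"
    using assms(5) unfolding P14_def diamond_def by blast
  obtain C where C: "\<And>a. is_limit r a \<Longrightarrow> club_in r (C a) a"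
    "\<And>a c. c \<in> acc r (C a) \<Longrightarrow> C c = C a \<inter> underS r c"
    "\<And>B. cofinal B r \<Longrightarrow> stationary r {a. is_sup r {b\<in>C a. succ_omega r {c\<in>C a. ord_le r b c} \<subseteq> B} a}"
    using assms(5) unfolding P14_def by blast
  interpret slim_construction r U C A pr
    by unfold_locales (fact assms C A pr)+
  obtain G where "\<And>a. spec G a (G a)" using stages_exist by blast
  then interpret slim_stages r U C A pr G by unfold_locales
  show ?thesis
    using T_downward_closed T_prolific T_slim T_souslin ascent_injective by blast
qed

end
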